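(* Let $M$ be a Markov chain and $\varphi$ a PHFL formula such that $\Sigma;\Delta\vdash_M\varphi:\kappa$ is derivable. Then for every $\eta\in[\![\Sigma]\!]$, $[\![\mathrm{tr}(\Sigma)\vdash\lambda\Delta.\varphi:\mathrm{tr}(\Delta\to\kappa)]\!](\eta)\in[\![\Delta\to\kappa]\!]$.
   Context: PHFL over $M=(S,P,L,s_{in})$ ($S=\{s_1,\dots,s_n\}$ finite, $P$ stochastic, $L:AP\to2^S$): formulas $\varphi::=p\mid X\mid\varphi_1\lor\varphi_2\mid\varphi_1\land\varphi_2\mid[\varphi]_J\mid\Box\varphi\mid\Diamond\varphi\mid\bigcirc\varphi\mid\mu X.\varphi\mid\nu X.\varphi\mid\lambda X.\varphi\mid\varphi_1\varphi_2$ ($J$ is "$>r$" or "$\ge r$", rational $r\in[0,1]$, excluding $>1,\ge0$), simply typed over $\tau::=\mathbf{Prop}\mid\tau_1\to\tau_2$. Semantics: $[\![\mathbf{Prop}]\!]=[0,1]^S$, monotone functions at higher types, pointwise orders; $[\![p]\!](s)=1$ iff $s\in L(p)$ else $0$; $\land,\lor$ pointwise min/max; $[\varphi]_J$ is $1$ at $s$ iff $[\![\varphi]\!](s)\in J$, else $0$; $\Box/\Diamond$ min/max over $s'$ with $P(s,s')>0$; $[\![\bigcirc\varphi]\!](s)=\sum_{s'}P(s,s')[\![\varphi]\!](s')$; $\mu,\nu$ least/greatest fixpoints; $\lambda$, application as usual. Refined types $\kappa::=\mathbf{Prop}_{T,U}\mid\mathbf{Prop}_{T,U}\to\kappa$ ($T,U\subseteq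 S$ disjoint), erasure $\mathrm{tr}$ (drop subscripts). $[\![\mathbf{Prop}_{T,U}]\!]=\{v\in[0,1]^S\mid v|_T=0,v|_U=1\}$; for $\kappa=\mathbf{Prop}_{T_1,U_1}\to\cdots\to\mathbf{Prop}_{T_k,U_k}\to\mathbf{Prop}_{T,U}$ with $k\ge1$, $[\![\kappa]\!]$ is the set of $f\in[\![\mathrm{tr}(\kappa)]\!]$ affine on $D=\prod_i[\![\mathbf{Prop}_{T_i,U_i}]\!]$ (for each $s_\ell$ there are reals $c^\ell_0,c^\ell_{i,j}$ with $f\,v_1\cdots v_k\,s_\ell=c^\ell_0+\sum_{i,j}c^\ell_{i,j}v_i(s_j)$ on $D$) with $f\,v_1\cdots v_k\in[\![\mathbf{Prop}_{T,U}]\!]$ for all $(v_i)\in D$. For $\Delta=(Y_1:\mathbf{Prop}_{T_1,U_1},\dots,Y_m:\mathbf{Prop}_{T_m,U_m})$: $\lambda\Delta.\varphi=\lambda Y_1.\cdots\lambda Y_m.\varphi$ and $\Delta\to\kappa=\mathbf{Prop}_{T_1,U_1}\to\cdots\to\mathbf{Prop}_{T_m,U_m}\to\kappa$. $[\![\Sigma]\!]$ is the set of interpretations $\eta$ of $\mathrm{tr}(\Sigma)$ with $\eta(X)\in[\![\Sigma(X)]\!]$ for every $X$. Judgments $\Sigma;\Delta\vdash_M\varphi:\kappa$ ($\Sigma$ a set of bindings $X:\kappa$, $\Delta$ a sequence of bindings $Y:\mathbf{Prop}_{T,U}$, disjoint domains): (WeakTU) from $\Sigma;\Delta\vdash\varphi:\mathbf{Prop}_{T,U}$,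 $T'\subseteq T$, $U'\subseteq U$ infer $\Sigma;\Delta\vdash\varphi:\mathbf{Prop}_{T',U'}$; (Weak) from $\Sigma;\Delta\vdash\varphi:\kappa$ infer $\Sigma;X:\mathbf{Prop}_{T,U},\Delta\vdash\varphi:\kappa$; (Ex) swap adjacent bindings in $\Delta$; (AP) $\Sigma;\emptyset\vdash p:\mathbf{Prop}_{S\setminus L(p),L(p)}$; (FVar) $\Sigma,X:\kappa;\emptyset\vdash X:\kappa$; (Var) $\Sigma;X:\mathbf{Prop}_{T,U}\vdash X:\mathbf{Prop}_{T,U}$; (Mu) from $\Sigma,X:\kappa;\emptyset\vdash\varphi:\kappa$, $\kappa$ of the form $\cdots\to\mathbf{Prop}_{T,\emptyset}$, infer $\Sigma;\emptyset\vdash\mu X.\varphi:\kappa$; (Nu) same with $\kappa$ of the form $\cdots\to\mathbf{Prop}_{\emptyset,U}$ for $\nu X.\varphi$; (Abs) from $\Sigma;\Delta,X:\mathbf{Prop}_{T,U}\vdash\varphi:\kappa$ infer $\Sigma;\Delta\vdash\lambda X.\varphi:\mathbf{Prop}_{T,U}\to\kappa$; (App) from $\Sigma;\Delta\vdash\varphi_1:\mathbf{Prop}_{T,U}\to\kappa$, $\Sigma;\Delta\vdash\varphi_2:\mathbf{Prop}_{T,U}$ infer $\Sigma;\Delta\vdash\varphi_1\varphi_2:\kappa$; (Conj)/(Disj) from $\Sigma;\Delta\vdash\varphi_i:\mathbf{Prop}_{T_i,U_i}$ and ($\Delta\ne\emptyset\Rightarrow T_1\cup U_1\cup T_2\cup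 U_2=S$) infer $\varphi_1\land\varphi_2:\mathbf{Prop}_{T_1\cup T_2,U_1\cap U_2}$, resp. $\varphi_1\lor\varphi_2:\mathbf{Prop}_{T_1\cap T_2,U_1\cup U_2}$; (J) from $\Sigma;\emptyset\vdash\varphi:\mathbf{Prop}_{T,U}$ infer $\Sigma;\emptyset\vdash[\varphi]_J:\mathbf{Prop}_{T,U}$; (Min) from $\Sigma;\emptyset\vdash\varphi:\mathbf{Prop}_{T,U}$ infer $\Sigma;\emptyset\vdash\Box\varphi:\mathbf{Prop}_{T',U'}$, $T'=\{s\mid\exists s'\in T.P(s,s')>0\}$, $U'=\{s\mid\forall s'.P(s,s')>0\Rightarrow s'\in U\}$; (Max) from $\Sigma;\emptyset\vdash\varphi:\mathbf{Prop}_{T,U}$ infer $\Sigma;\emptyset\vdash\Diamond\varphi:\mathbf{Prop}_{T',U'}$, $T'=\{s\mid\forall s'.P(s,s')>0\Rightarrow s'\in T\}$, $U'=\{s\mid\exists s'\in U.P(s,s')>0\}$; (Avg) from $\Sigma;\Delta\vdash\varphi:\mathbf{Prop}_{T,U}$ infer $\Sigma;\Delta\vdash\bigcirc\varphi:\mathbf{Prop}_{T',U'}$, $T'=\{s\mid\forall s'.P(s,s')>0\Rightarrow s'\in T\}$, $U'=\{s\mid\forall s'.P(s,s')>0\Rightarrow s'\in U\}$. *)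

theory Defs
  imports Complex_Main "HOL-Library.FuncSet"
begin

text \<open>
  The state space \<open>S\<close> is a finite type \<open>'s\<close>, the atomic propositions are the elements of
  \<open>'p\<close>, and the variables of formulas are the elements of \<open>'x\<close>.
\<close>

record ('s, 'p) chain =
  trans :: "'s \<Rightarrow> 's \<Rightarrow> real"
  label :: "'p \<Rightarrow> 's set"
  init :: 's

definition markov_chain :: "('s::finite, 'p) chain \<Rightarrow> bool" where
  "markov_chain M \<longleftrightarrow>
     (\<forall>s t. 0 \<le> trans M s t) \<and> (\<forall>s. (\<Sum>t\<in>UNIV. trans M s t) = 1)"

definition succs :: "('s, 'p) chain \<Rightarrow> 's \<Rightarrow> 's set" where
  "succs M s = {t. trans M s t > 0}"


section \<open>Formulas\<close>

datatype threshold = Gt rat | Ge rat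

text \<open>The intervals \<open>> 1\<close> and \<open>\<ge> 0\<close> are excluded.\<close>

fun valid_threshold :: "threshold \<Rightarrow> bool" where
  "valid_threshold (Gt r) \<longleftrightarrow> 0 \<le> r \<and> r < 1"
| "valid_threshold (Ge r) \<longleftrightarrow> 0 < r \<and> r \<le> 1"

fun in_threshold :: "real \<Rightarrow> threshold \<Rightarrow> bool" where
  "in_threshold a (Gt r) \<longleftrightarrow> a > of_rat r"
| "in_threshold a (Ge r) \<longleftrightarrow> a \<ge> of_rat r"

datatype ('p, 'x) form =
    AP 'p
  | Var 'x
  | Or "('p, 'x) form" "('p, 'x) form"
  | And "('p, 'x) form" "('p, 'x) form"
  | Thr "('p, 'x) form" threshold
  | Box "('p, 'x) form"
  | Dia "('p, 'x) form"
  | Next "('p, 'x) form"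
  | Mu 'x "('p, 'x) form"
  | Nu 'x "('p, 'x) form"
  | Lam 'x "('p, 'x) form"
  | App "('p, 'x) form" "('p, 'x) form"

primrec phfl_formula :: "('p, 'x) form \<Rightarrow> bool" where
  "phfl_formula (AP p) \<longleftrightarrow> True"
| "phfl_formula (Var X) \<longleftrightarrow> True"
| "phfl_formula (Or \<phi> \<psi>) \<longleftrightarrow> phfl_formula \<phi> \<and> phfl_formula \<psi>"
| "phfl_formula (And \<phi> \<psi>) \<longleftrightarrow> phfl_formula \<phi> \<and> phfl_formula \<psi>"
| "phfl_formula (Thr \<phi> J) \<longleftrightarrow> phfl_formula \<phi> \<and> valid_threshold J"
| "phfl_formula (Box \<phi>) \<longleftrightarrow> phfl_formula \<phi>"
| "phfl_formula (Dia \<phi>) \<longleftrightarrow> phfl_formula \<phi>"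
| "phfl_formula (Next \<phi>) \<longleftrightarrow> phfl_formula \<phi>"
| "phfl_formula (Mu X \<phi>) \<longleftrightarrow> phfl_formula \<phi>"
| "phfl_formula (Nu X \<phi>) \<longleftrightarrow> phfl_formula \<phi>"
| "phfl_formula (Lam X \<phi>) \<longleftrightarrow> phfl_formula \<phi>"
| "phfl_formula (App \<phi> \<psi>) \<longleftrightarrow> phfl_formula \<phi> \<and> phfl_formula \<psi>"


section \<open>Simple types and their interpretation\<close>

text \<open>
  Only the simple types \<open>Prop \<rightarrow> \<dots> \<rightarrow> Prop \<rightarrow> Prop\<close> are represented: \<open>PropTo \<tau>\<close> stands for
  \<open>Prop \<rightarrow> \<tau>\<close>.  These are exactly the erasures of refined types, and every variable and
  subformula occurring in a derivation of the refined type system has such a type.  A single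
  HOL type cannot contain the full function spaces of all finite orders, whereas the values
  of the types considered here are the elements of the datatype \<open>val\<close> below.
\<close>

datatype ty = Prop | PropTo ty

datatype 's val =
    VProp (the_prop: "'s \<Rightarrow> real")
  | VFun (the_fun: "('s \<Rightarrow> real) \<Rightarrow> 's val")

definition unit_val :: "('s \<Rightarrow> real) set" where
  "unit_val = {v. \<forall>s. 0 \<le> v s \<and> v s \<le> 1}"

primrec le_val :: "ty \<Rightarrow> 's val \<Rightarrow> 's val \<Rightarrow> bool" where
  "le_val Prop d e \<longleftrightarrow> the_prop d \<le> the_prop e"
| "le_val (PropTo \<tau>) d e \<longleftrightarrow> (\<forall>v\<in>unit_val. le_val \<tau> (the_fun d v) (the_fun e v))"

text \<open>
  Functions are extensional, i.e. \<open>undefined\<close> outside \<open>[0,1]\<^sup>S\<close>, so that \<open>le_val \<tau>\<close> is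
  antisymmetric on \<open>dom_ty \<tau>\<close>.
\<close>

primrec dom_ty :: "ty \<Rightarrow> 's val set" where
  "dom_ty Prop = VProp ` unit_val"
| "dom_ty (PropTo \<tau>) =
     VFun ` {f \<in> unit_val \<rightarrow>\<^sub>E dom_ty \<tau>.
               \<forall>u\<in>unit_val. \<forall>v\<in>unit_val. u \<le> v \<longrightarrow> le_val \<tau> (f u) (f v)}"


section \<open>Simple typing and semantics of formulas\<close>

inductive simply_typed :: "('x \<rightharpoonup> ty) \<Rightarrow> ('p, 'x) form \<Rightarrow> ty \<Rightarrow> bool" where
  "simply_typed \<Gamma> (AP p) Prop"
| "\<Gamma> X = Some \<tau> \<Longrightarrow> simply_typed \<Gamma> (Var X) \<tau>"
| "simply_typed \<Gamma> \<phi> Prop \<Longrightarrow> simply_typed \<Gamma> \<psi> Prop \<Longrightarrow> simply_typed \<Gamma> (Or \<phi> \<psi>) Prop"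
| "simply_typed \<Gamma> \<phi> Prop \<Longrightarrow> simply_typed \<Gamma> \<psi> Prop \<Longrightarrow> simply_typed \<Gamma> (And \<phi> \<psi>) Prop"
| "simply_typed \<Gamma> \<phi> Prop \<Longrightarrow> simply_typed \<Gamma> (Thr \<phi> J) Prop"
| "simply_typed \<Gamma> \<phi> Prop \<Longrightarrow> simply_typed \<Gamma> (Box \<phi>) Prop"
| "simply_typed \<Gamma> \<phi> Prop \<Longrightarrow> simply_typed \<Gamma> (Dia \<phi>) Prop"
| "simply_typed \<Gamma> \<phi> Prop \<Longrightarrow> simply_typed \<Gamma> (Next \<phi>) Prop"
| "simply_typed (\<Gamma>(X \<mapsto> \<tau>)) \<phi> \<tau> \<Longrightarrow> simply_typed \<Gamma> (Mu X \<phi>) \<tau>"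
| "simply_typed (\<Gamma>(X \<mapsto> \<tau>)) \<phi> \<tau> \<Longrightarrow> simply_typed \<Gamma> (Nu X \<phi>) \<tau>"
| "simply_typed (\<Gamma>(X \<mapsto> Prop)) \<phi> \<tau> \<Longrightarrow> simply_typed \<Gamma> (Lam X \<phi>) (PropTo \<tau>)"
| "simply_typed \<Gamma> \<phi> (PropTo \<tau>) \<Longrightarrow> simply_typed \<Gamma> \<psi> Prop \<Longrightarrow> simply_typed \<Gamma> (App \<phi> \<psi>) \<tau>"

definition least_fix :: "ty \<Rightarrow> ('s val \<Rightarrow> 's val) \<Rightarrow> 's val" where
  "least_fix \<tau> F =
     (THE d. d \<in> dom_ty \<tau> \<and> F d = d \<and> (\<forall>e\<in>dom_ty \<tau>. F e = e \<longrightarrow> le_val \<tau> d e))"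

definition greatest_fix :: "ty \<Rightarrow> ('s val \<Rightarrow> 's val) \<Rightarrow> 's val" where
  "greatest_fix \<tau> F =
     (THE d. d \<in> dom_ty \<tau> \<and> F d = d \<and> (\<forall>e\<in>dom_ty \<tau>. F e = e \<longrightarrow> le_val \<tau> e d))"

text \<open>
  \<open>sem M \<phi> \<tau> \<eta>\<close> is the value of \<open>\<phi>\<close> at type \<open>\<tau>\<close>; it is meaningful only if \<open>\<phi>\<close> has type
  \<open>\<tau>\<close>.  Environments are total functions; their values at variables outside the typing
  context are irrelevant.
\<close>

primrec sem ::
  "('s::finite, 'p) chain \<Rightarrow> ('p, 'x) form \<Rightarrow> ty \<Rightarrow> ('x \<Rightarrow> 's val) \<Rightarrow> 's val"
where
  "sem M (AP p) \<tau> \<eta> = VProp (\<lambda>s. if s \<in> label M p then 1 else 0)"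
| "sem M (Var X) \<tau> \<eta> = \<eta> X"
| "sem M (Or \<phi> \<psi>) \<tau> \<eta> =
     VProp (\<lambda>s. max (the_prop (sem M \<phi> Prop \<eta>) s) (the_prop (sem M \<psi> Prop \<eta>) s))"
| "sem M (And \<phi> \<psi>) \<tau> \<eta> =
     VProp (\<lambda>s. min (the_prop (sem M \<phi> Prop \<eta>) s) (the_prop (sem M \<psi> Prop \<eta>) s))"
| "sem M (Thr \<phi> J) \<tau> \<eta> =
     VProp (\<lambda>s. if in_threshold (the_prop (sem M \<phi> Prop \<eta>) s) J then 1 else 0)"
| "sem M (Box \<phi>) \<tau> \<eta> = VProp (\<lambda>s. Min (the_prop (sem M \<phi> Prop \<eta>) ` succs M s))"
| "sem M (Dia \<phi>) \<tau> \<eta> = VProp (\<lambda>s. Max (the_prop (sem M \<phi> Prop \<eta>) ` succs M s))"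
| "sem M (Next \<phi>) \<tau> \<eta> =
     VProp (\<lambda>s. \<Sum>t\<in>UNIV. trans M s t * the_prop (sem M \<phi> Prop \<eta>) t)"
| "sem M (Mu X \<phi>) \<tau> \<eta> = least_fix \<tau> (\<lambda>d. sem M \<phi> \<tau> (\<eta>(X := d)))"
| "sem M (Nu X \<phi>) \<tau> \<eta> = greatest_fix \<tau> (\<lambda>d. sem M \<phi> \<tau> (\<eta>(X := d)))"
| "sem M (Lam X \<phi>) \<tau> \<eta> =
     (case \<tau> of
        Prop \<Rightarrow> undefined
      | PropTo \<tau>' \<Rightarrow> VFun (\<lambda>v\<in>unit_val. sem M \<phi> \<tau>' (\<eta>(X := VProp v))))"
| "sem M (App \<phi> \<psi>) \<tau> \<eta> = the_fun (sem M \<phi> (PropTo \<tau>) \<eta>) (the_prop (sem M \<psi> Prop \<eta>))"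

text \<open>The semantics \<open>\<lbrakk>\<Gamma> \<turnstile> \<phi> : \<tau>\<rbrakk>(\<eta>)\<close> of a judgment is left unspecified if the judgment fails.\<close>

definition denotation ::
  "('s::finite, 'p) chain \<Rightarrow> ('x \<rightharpoonup> ty) \<Rightarrow> ('p, 'x) form \<Rightarrow> ty \<Rightarrow> ('x \<Rightarrow> 's val) \<Rightarrow> 's val"
where
  "denotation M \<Gamma> \<phi> \<tau> \<eta> = (if simply_typed \<Gamma> \<phi> \<tau> then sem M \<phi> \<tau> \<eta> else undefined)"


section \<open>Refined types and their interpretation\<close>

text \<open>\<open>RProp T U\<close> is \<open>Prop\<^bsub>T,U\<^esub>\<close>, and \<open>RFun T U \<kappa>\<close> is \<open>Prop\<^bsub>T,U\<^esub> \<rightarrow> \<kappa>\<close>.\<close>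

datatype 's rty =
    RProp "'s set" "'s set"
  | RFun "'s set" "'s set" "'s rty"

primrec wf_rty :: "'s rty \<Rightarrow> bool" where
  "wf_rty (RProp T U) \<longleftrightarrow> T \<inter> U = {}"
| "wf_rty (RFun T U \<kappa>) \<longleftrightarrow> T \<inter> U = {} \<and> wf_rty \<kappa>"

primrec tr :: "'s rty \<Rightarrow> ty" where
  "tr (RProp T U) = Prop"
| "tr (RFun T U \<kappa>) = PropTo (tr \<kappa>)"

primrec arg_types :: "'s rty \<Rightarrow> ('s set \<times> 's set) list" where
  "arg_types (RProp T U) = []"
| "arg_types (RFun T U \<kappa>) = (T, U) # arg_types \<kappa>"

primrec res_type :: "'s rty \<Rightarrow> 's set \<times> 's set" where
  "res_type (RProp T U) = (T, U)"
| "res_type (RFun T U \<kappa>) = res_type \<kappa>"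

definition prop_set :: "'s set \<times> 's set \<Rightarrow> ('s \<Rightarrow> real) set" where
  "prop_set TU = {v \<in> unit_val. (\<forall>s\<in>fst TU. v s = 0) \<and> (\<forall>s\<in>snd TU. v s = 1)}"

definition arg_set :: "'s rty \<Rightarrow> ('s \<Rightarrow> real) list set" where
  "arg_set \<kappa> = {vs. list_all2 (\<lambda>v TU. v \<in> prop_set TU) vs (arg_types \<kappa>)}"

definition apply_val :: "'s val \<Rightarrow> ('s \<Rightarrow> real) list \<Rightarrow> 's val" where
  "apply_val d vs = foldl the_fun d vs"

definition affine_on :: "('s::finite \<Rightarrow> real) list set \<Rightarrow> nat \<Rightarrow> 's val \<Rightarrow> bool" where
  "affine_on D k d \<longleftrightarrow>
     (\<forall>s. \<exists>(c0::real) (c :: nat \<Rightarrow> 's \<Rightarrow> real). \<forall>vs\<in>D.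
        the_prop (apply_val d vs) s = c0 + (\<Sum>i<k. \<Sum>t\<in>UNIV. c i t * (vs ! i) t))"

definition dom_rty :: "'s::finite rty \<Rightarrow> 's val set" where
  "dom_rty \<kappa> =
     (case \<kappa> of
        RProp T U \<Rightarrow> VProp ` prop_set (T, U)
      | RFun _ _ _ \<Rightarrow>
          {d \<in> dom_ty (tr \<kappa>).
             affine_on (arg_set \<kappa>) (length (arg_types \<kappa>)) d \<and>
             (\<forall>vs\<in>arg_set \<kappa>. apply_val d vs \<in> VProp ` prop_set (res_type \<kappa>))})"

definition tr_env :: "('x \<rightharpoonup> 's rty) \<Rightarrow> ('x \<rightharpoonup> ty)" where
  "tr_env \<Sigma> = map_option tr \<circ> \<Sigma>"

definition dom_env :: "('x \<rightharpoonup> 's::finite rty) \<Rightarrow> ('x \<Rightarrow> 's val) set" where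
  "dom_env \<Sigma> =
     {\<eta>. \<forall>X \<kappa>. \<Sigma> X = Some \<kappa> \<longrightarrow> \<eta> X \<in> dom_ty (tr \<kappa>) \<and> \<eta> X \<in> dom_rty \<kappa>}"


section \<open>Refined type system\<close>

type_synonym ('x, 's) binding = "'x \<times> 's set \<times> 's set"

definition lam_seq :: "('x, 's) binding list \<Rightarrow> ('p, 'x) form \<Rightarrow> ('p, 'x) form" where
  "lam_seq \<Delta> \<phi> = foldr (\<lambda>(Y, T, U). Lam Y) \<Delta> \<phi>"

definition fun_seq :: "('x, 's) binding list \<Rightarrow> 's rty \<Rightarrow> 's rty" where
  "fun_seq \<Delta> \<kappa> = foldr (\<lambda>(Y, T, U). RFun T U) \<Delta> \<kappa>"

text \<open>
  Well-formedness of the contexts (disjointness of \<open>T\<close> and \<open>U\<close> in all bindings, and of the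
  domains) is imposed at the leaves of derivations and wherever a binding is added; the
  remaining rules preserve it.  Environments \<open>\<Sigma>\<close> are finite or infinite sets of bindings with
  at most one binding per variable.
\<close>

definition wf_env :: "('x \<rightharpoonup> 's rty) \<Rightarrow> bool" where
  "wf_env \<Sigma> \<longleftrightarrow> (\<forall>\<kappa>\<in>ran \<Sigma>. wf_rty \<kappa>)"

inductive has_type ::
  "('s, 'p) chain \<Rightarrow> ('x \<rightharpoonup> 's rty) \<Rightarrow> ('x, 's) binding list \<Rightarrow> ('p, 'x) form \<Rightarrow> 's rty \<Rightarrow> bool"
  for M :: "('s, 'p) chain"
where
  WeakTU: "has_type M \<Sigma> \<Delta> \<phi> (RProp T U) \<Longrightarrow> T' \<subseteq> T \<Longrightarrow> U' \<subseteq> U \<Longrightarrow>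
    has_type M \<Sigma> \<Delta> \<phi> (RProp T' U')"
| Weak: "has_type M \<Sigma> \<Delta> \<phi> \<kappa> \<Longrightarrow> X \<notin> dom \<Sigma> \<Longrightarrow> X \<notin> fst ` set \<Delta> \<Longrightarrow> T \<inter> U = {} \<Longrightarrow>
    has_type M \<Sigma> ((X, T, U) # \<Delta>) \<phi> \<kappa>"
| Ex: "has_type M \<Sigma> (\<Delta>1 @ b1 # b2 # \<Delta>2) \<phi> \<kappa> \<Longrightarrow>
    has_type M \<Sigma> (\<Delta>1 @ b2 # b1 # \<Delta>2) \<phi> \<kappa>"
| AP: "wf_env \<Sigma> \<Longrightarrow> has_type M \<Sigma> [] (AP p) (RProp (- label M p) (label M p))"
| FVar: "wf_env \<Sigma> \<Longrightarrow> \<Sigma> X = Some \<kappa> \<Longrightarrow> has_type M \<Sigma> [] (Var X) \<kappa>"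
| Var: "wf_env \<Sigma> \<Longrightarrow> X \<notin> dom \<Sigma> \<Longrightarrow> T \<inter> U = {} \<Longrightarrow>
    has_type M \<Sigma> [(X, T, U)] (Var X) (RProp T U)"
| Mu: "has_type M (\<Sigma>(X \<mapsto> \<kappa>)) [] \<phi> \<kappa> \<Longrightarrow> X \<notin> dom \<Sigma> \<Longrightarrow> snd (res_type \<kappa>) = {} \<Longrightarrow>
    has_type M \<Sigma> [] (Mu X \<phi>) \<kappa>"
| Nu: "has_type M (\<Sigma>(X \<mapsto> \<kappa>)) [] \<phi> \<kappa> \<Longrightarrow> X \<notin> dom \<Sigma> \<Longrightarrow> fst (res_type \<kappa>) = {} \<Longrightarrow>
    has_type M \<Sigma> [] (Nu X \<phi>) \<kappa>"
| Abs: "has_type M \<Sigma> (\<Delta> @ [(X, T, U)]) \<phi> \<kappa> \<Longrightarrow> has_type M \<Sigma> \<Delta> (Lam X \<phi>) (RFun T U \<kappa>)"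
| App: "has_type M \<Sigma> \<Delta> \<phi> (RFun T U \<kappa>) \<Longrightarrow> has_type M \<Sigma> \<Delta> \<psi> (RProp T U) \<Longrightarrow>
    has_type M \<Sigma> \<Delta> (App \<phi> \<psi>) \<kappa>"
| Conj: "has_type M \<Sigma> \<Delta> \<phi> (RProp T1 U1) \<Longrightarrow> has_type M \<Sigma> \<Delta> \<psi> (RProp T2 U2) \<Longrightarrow>
    (\<Delta> \<noteq> [] \<Longrightarrow> T1 \<union> U1 \<union> T2 \<union> U2 = UNIV) \<Longrightarrow>
    has_type M \<Sigma> \<Delta> (And \<phi> \<psi>) (RProp (T1 \<union> T2) (U1 \<inter> U2))"
| Disj: "has_type M \<Sigma> \<Delta> \<phi> (RProp T1 U1) \<Longrightarrow> has_type M \<Sigma> \<Delta> \<psi> (RProp T2 U2) \<Longrightarrow>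
    (\<Delta> \<noteq> [] \<Longrightarrow> T1 \<union> U1 \<union> T2 \<union> U2 = UNIV) \<Longrightarrow>
    has_type M \<Sigma> \<Delta> (Or \<phi> \<psi>) (RProp (T1 \<inter> T2) (U1 \<union> U2))"
| J: "has_type M \<Sigma> [] \<phi> (RProp T U) \<Longrightarrow> has_type M \<Sigma> [] (Thr \<phi> J) (RProp T U)"
| Min: "has_type M \<Sigma> [] \<phi> (RProp T U) \<Longrightarrow>
    has_type M \<Sigma> [] (Box \<phi>) (RProp {s. \<exists>t\<in>T. trans M s t > 0} {s. \<forall>t. trans M s t > 0 \<longrightarrow> t \<in> U})"
| Max: "has_type M \<Sigma> [] \<phi> (RProp T U) \<Longrightarrow>
    has_type M \<Sigma> [] (Dia \<phi>) (RProp {s. \<forall>t. trans M s t > 0 \<longrightarrow> t \<in> T} {s. \<exists>t\<in>U. trans M s t > 0})"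
| Avg: "has_type M \<Sigma> \<Delta> \<phi> (RProp T U) \<Longrightarrow>
    has_type M \<Sigma> \<Delta> (Next \<phi>)
      (RProp {s. \<forall>t. trans M s t > 0 \<longrightarrow> t \<in> T} {s. \<forall>t. trans M s t > 0 \<longrightarrow> t \<in> U})"

end

theory Submission
  imports Defs
begin

text \<open>
  A map on a box \<open>\<Prod>\<^sub>i \<lbrakk>Prop\<^bsub>T\<^sub>i,U\<^sub>i\<^esub>\<rbrakk>\<close> is affine iff it preserves convex combinations, and this is
  preserved by all constructors of the refined type system: at a state where minimum or maximum is
  applied below a nonempty context, one operand is constantly \<open>0\<close> or \<open>1\<close>.  Affine maps respecting
  the bounds of \<open>\<kappa>\<close> are closed under pointwise limits, and they contain the bottom (top) element
  if the result type permits it; hence the least (greatest) fixpoint of a monotone operator that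
  preserves them, obtained as the limit of a chain of such maps, is again affine.
\<close>

section \<open>The simple types\<close>

text \<open>Mixtures are used instead of coefficients because coefficients are not unique
  (coordinates in T and U are constant) and change under application and limits, whereas each mixing
  equation is a closed condition that composes directly. Thresholds, \<box>, \<diamond> and
  fixpoints do not respect mixtures. Their rules, however, demand an empty \<Delta>, and only
  variables of \<Delta> are ever mixed; variables of \<Sigma> keep one value, which is related to
  itself. With \<Delta> empty all environments coincide and the mixing equation at type Prop is
  trivial. For fixpoints there are two obstacles. The sets \<open>dom_rty \<kappa>\<close> are not
  lattices, since the maximum of two affine maps is rarely affine, so Knaster-Tarski cannot be
  applied inside them. Thresholds are discontinuous, so iterating along the natural numbers may stop
  short of the fixpoint. Hence chains of arbitrary length are needed, and their limits are taken
  along filters.\<close>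

lemma le_val_refl: "le_val \<tau> d d"
  by (induction \<tau> arbitrary: d) auto

lemma le_val_trans: "le_val \<tau> d e \<Longrightarrow> le_val \<tau> e f \<Longrightarrow> le_val \<tau> d f"
  by (induction \<tau> arbitrary: d e f) (auto intro: order_trans)

text \<open>The order only compares arguments in \<open>unit_val\<close>; extensionality of the
  functions settles all other arguments.\<close>

lemma le_val_antisym:
  "d \<in> dom_ty \<tau> \<Longrightarrow> e \<in> dom_ty \<tau> \<Longrightarrow> le_val \<tau> d e \<Longrightarrow> le_val \<tau> e d \<Longrightarrow> d = e"
proof (induction \<tau> arbitrary: d e)
  case Prop
  then show ?case by auto
next
  case (PropTo \<tau>)
  then obtain f g where d: "d = VFun f" and e: "e = VFun g"
    and f: "f \<in> unit_val \<rightarrow>\<^sub>E dom_ty \<tau>" and g: "g \<in> unit_val \<rightarrow>\<^sub>E dom_ty \<tau>" by auto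
  have "f = g"
  proof (rule PiE_ext[OF f g])
    fix v :: "'a \<Rightarrow> real" assume v: "v \<in> unit_val"
    show "f v = g v"
      using PropTo.prems d e v f g by (intro PropTo.IH) (auto simp: PiE_iff)
  qed
  then show ?case using d e by simp
qed

lemma the_fun_in_dom_ty:
  "d \<in> dom_ty (PropTo \<tau>) \<Longrightarrow> v \<in> unit_val \<Longrightarrow> the_fun d v \<in> dom_ty \<tau>"
  by (auto simp: PiE_iff)

lemma the_fun_mono:
  "d \<in> dom_ty (PropTo \<tau>) \<Longrightarrow> u \<in> unit_val \<Longrightarrow> v \<in> unit_val \<Longrightarrow> u \<le> v \<Longrightarrow>
    le_val \<tau> (the_fun d u) (the_fun d v)"
  by auto

text \<open>For c = 0 and c = 1 these are the bottom and the top of \<open>dom_ty \<tau>\<close>,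
  the starting points for least and greatest fixpoints.\<close>

primrec const_val :: "real \<Rightarrow> ty \<Rightarrow> 's val" where
  "const_val c Prop = VProp (\<lambda>_. c)"
| "const_val c (PropTo \<tau>) = VFun (\<lambda>v\<in>unit_val. const_val c \<tau>)"

lemma const_val_in_dom_ty: "0 \<le> c \<Longrightarrow> c \<le> 1 \<Longrightarrow> const_val c \<tau> \<in> dom_ty \<tau>"
  by (induction \<tau>) (auto simp: unit_val_def le_val_refl)

lemma const_val_0_least: "d \<in> dom_ty \<tau> \<Longrightarrow> le_val \<tau> (const_val 0 \<tau>) d"
  by (induction \<tau> arbitrary: d) (auto simp: unit_val_def le_fun_def PiE_iff)

lemma const_val_1_greatest: "d \<in> dom_ty \<tau> \<Longrightarrow> le_val \<tau> d (const_val 1 \<tau>)"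
  by (induction \<tau> arbitrary: d) (auto simp: unit_val_def le_fun_def PiE_iff)


section \<open>Pointwise limits\<close>

text \<open>The family \<open>p\<close> is indexed separately from the values, because the recursion
  replaces each value by its application to \<open>v\<close> while the filter stays the
  same.\<close>

primrec conv_val :: "ty \<Rightarrow> 'i filter \<Rightarrow> ('i \<Rightarrow> 's val) \<Rightarrow> 's val \<Rightarrow> bool" where
  "conv_val Prop G p l \<longleftrightarrow> (\<forall>s. ((\<lambda>i. the_prop (p i) s) \<longlongrightarrow> the_prop l s) G)"
| "conv_val (PropTo \<tau>) G p l \<longleftrightarrow>
     (\<forall>v\<in>unit_val. conv_val \<tau> G (\<lambda>i. the_fun (p i) v) (the_fun l v))"

lemma conv_val_le:
  assumes "G \<noteq> bot"
  shows "conv_val \<tau> G p l \<Longrightarrow> conv_val \<tau> G q m \<Longrightarrow> \<forall>\<^sub>F i in G. le_val \<tau> (p i) (q i) \<Longrightarrow>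
    le_val \<tau> l m"
proof (induction \<tau> arbitrary: p q l m)
  case Prop
  have "the_prop l s \<le> the_prop m s" for s
    by (rule tendsto_le[OF assms, where f = "\<lambda>i. the_prop (q i) s" and g = "\<lambda>i. the_prop (p i) s"])
      (use Prop in \<open>auto elim!: eventually_mono simp: le_fun_def\<close>)
  then show ?case by (simp add: le_fun_def)
next
  case (PropTo \<tau>)
  show ?case unfolding le_val.simps
  proof
    fix v :: "'b \<Rightarrow> real" assume v: "v \<in> unit_val"
    have "\<forall>\<^sub>F i in G. le_val \<tau> (the_fun (p i) v) (the_fun (q i) v)"
      using PropTo.prems(3) by (rule eventually_mono) (use v in auto)
    then show "le_val \<tau> (the_fun l v) (the_fun m v)"
      using PropTo.prems(1,2) v by (intro PropTo.IH) auto
  qed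
qed

lemma conv_val_const: "conv_val \<tau> G (\<lambda>_. d) d"
  by (induction \<tau> arbitrary: d) auto

section \<open>Limits along chains, in either direction of the order\<close>

text \<open>Admitting the converse order lets one argument serve both least and greatest
  fixpoints.\<close>

definition val_order :: "ty \<Rightarrow> ('s val \<Rightarrow> 's val \<Rightarrow> bool) \<Rightarrow> bool" where
  "val_order \<tau> r \<longleftrightarrow> r = le_val \<tau> \<or> r = (\<lambda>d e. le_val \<tau> e d)"

lemma val_order_refl: "val_order \<tau> r \<Longrightarrow> r d d"
  by (auto simp: val_order_def le_val_refl)

lemma val_order_transp: "val_order \<tau> r \<Longrightarrow> transp r"
  by (auto simp: val_order_def intro!: transpI intro: le_val_trans)

lemma val_order_antisym:
  "val_order \<tau> r \<Longrightarrow> d \<in> dom_ty \<tau> \<Longrightarrow> e \<in> dom_ty \<tau> \<Longrightarrow> r d e \<Longrightarrow> r e d \<Longrightarrow> d = e"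
  by (auto simp: val_order_def intro: le_val_antisym)

text \<open>The filter generated by the tails of C: convergence along it is convergence of the chain
  as a net, whatever its order type.\<close>

definition chain_filter :: "('a \<Rightarrow> 'a \<Rightarrow> bool) \<Rightarrow> 'a set \<Rightarrow> 'a filter" where
  "chain_filter r C = (INF c\<in>C. principal {e \<in> C. r c e})"

text \<open>Of two tails one contains the other, so the tails form a filter base and no finite
  intersections arise.\<close>

lemma eventually_chain_filter:
  assumes "C \<noteq> {}" and total: "\<forall>c\<in>C. \<forall>d\<in>C. r c d \<or> r d c"
    and trans: "transp r"
  shows "eventually P (chain_filter r C) \<longleftrightarrow> (\<exists>c\<in>C. \<forall>e\<in>C. r c e \<longrightarrow> P e)"
proof -
  have "eventually P (chain_filter r C) \<longleftrightarrow> (\<exists>c\<in>C. eventually P (principal {e \<in> C. r c e}))"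
    unfolding chain_filter_def
  proof (rule eventually_INF_base[OF assms(1)])
    fix c d assume "c \<in> C" "d \<in> C"
    then consider "r c d" | "r d c" using total by blast
    then show "\<exists>x\<in>C. principal {e \<in> C. r x e} \<le>
        inf (principal {e \<in> C. r c e}) (principal {e \<in> C. r d e})"
    proof cases
      case 1
      then show ?thesis using \<open>d \<in> C\<close> by (auto intro!: bexI[of _ d] intro: transpD[OF trans])
    next
      case 2
      then show ?thesis using \<open>c \<in> C\<close> by (auto intro!: bexI[of _ c] intro: transpD[OF trans])
    qed
  qed
  then show ?thesis by (auto simp: eventually_principal)
qed

lemma chain_filter_tendsto:
  fixes f :: "'a \<Rightarrow> real"
  assumes "C \<noteq> {}" and "\<forall>c\<in>C. \<forall>d\<in>C. r c d \<or> r d c"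
    and "transp r"
    and mono: "\<And>c d. c \<in> C \<Longrightarrow> d \<in> C \<Longrightarrow> r c d \<Longrightarrow> f c \<le> f d"
    and bound: "\<And>c. c \<in> C \<Longrightarrow> f c \<le> B"
  shows "(f \<longlongrightarrow> (SUP c\<in>C. f c)) (chain_filter r C)"
proof (rule order_tendstoI)
  have bdd: "bdd_above (f ` C)" using bound by (auto intro!: bdd_aboveI)
  note ev = eventually_chain_filter[OF assms(1-3)]
  fix y assume "y < (SUP c\<in>C. f c)"
  then obtain c where "c \<in> C" "y < f c" using less_cSUP_iff[OF assms(1) bdd] by auto
  then show "\<forall>\<^sub>F x in chain_filter r C. y < f x"
    unfolding ev using mono less_le_trans by (intro bexI[of _ c]) blast+
next
  have bdd: "bdd_above (f ` C)" using bound by (auto intro!: bdd_aboveI)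
  note ev = eventually_chain_filter[OF assms(1-3)]
  fix y assume y: "(SUP c\<in>C. f c) < y"
  have "f c < y" if "c \<in> C" for c using cSUP_upper[OF that bdd] y by simp
  then show "\<forall>\<^sub>F x in chain_filter r C. f x < y" unfolding ev using assms(1) by blast
qed

text \<open>Both directions of monotonicity occur because \<open>r\<close> may be the converse of
  the order in which values are compared.\<close>

lemma chain_filter_convergent:
  fixes f :: "'a \<Rightarrow> real"
  assumes "C \<noteq> {}" and "\<forall>c\<in>C. \<forall>d\<in>C. r c d \<or> r d c"
    and "transp r"
    and mono: "(\<forall>c\<in>C. \<forall>d\<in>C. r c d \<longrightarrow> f c \<le> f d) \<or> (\<forall>c\<in>C. \<forall>d\<in>C. r c d \<longrightarrow> f d \<le> f c)"
    and bound: "\<And>c. c \<in> C \<Longrightarrow> 0 \<le> f c \<and> f c \<le> 1"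
  shows "\<exists>l. (f \<longlongrightarrow> l) (chain_filter r C)"
  using mono
proof
  assume "\<forall>c\<in>C. \<forall>d\<in>C. r c d \<longrightarrow> f c \<le> f d"
  then have "(f \<longlongrightarrow> (SUP c\<in>C. f c)) (chain_filter r C)"
    using bound by (intro chain_filter_tendsto[OF assms(1-3), where B = 1]) auto
  then show ?thesis by blast
next
  assume "\<forall>c\<in>C. \<forall>d\<in>C. r c d \<longrightarrow> f d \<le> f c"
  \<comment> \<open>Negation reduces the decreasing case to the increasing one; the bound 0 for - f
    comes from f being nonnegative.\<close>
  then have "((\<lambda>c. - f c) \<longlongrightarrow> (SUP c\<in>C. - f c)) (chain_filter r C)"
    using bound by (intro chain_filter_tendsto[OF assms(1-3), where B = 0]) auto
  from tendsto_minus[OF this] show ?thesis by auto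
qed

text \<open>The limit is assembled argument by argument. For a fixed argument the values form a
  monotone family over the same chain, which is why a family \<open>p\<close> over C occurs here and
  not C itself; monotonicity of the limit follows since inequalities pass to limits.\<close>

lemma chain_limit_exists:
  fixes p :: "'i \<Rightarrow> 's val"
  assumes C: "C \<noteq> {}" "\<forall>c\<in>C. \<forall>d\<in>C. r c d \<or> r d c"
    "transp r"
  shows "(\<And>c. c \<in> C \<Longrightarrow> p c \<in> dom_ty \<tau>) \<Longrightarrow>
    (\<forall>c\<in>C. \<forall>d\<in>C. r c d \<longrightarrow> le_val \<tau> (p c) (p d)) \<or>
    (\<forall>c\<in>C. \<forall>d\<in>C. r c d \<longrightarrow> le_val \<tau> (p d) (p c)) \<Longrightarrow>
    \<exists>l\<in>dom_ty \<tau>. conv_val \<tau> (chain_filter r C) p l"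
proof (induction \<tau> arbitrary: p)
  case Prop
  let ?G = "chain_filter r C"
  note ev = eventually_chain_filter[OF C]
  have nbot: "?G \<noteq> bot" using C(1,2) unfolding trivial_limit_def ev by blast
  have bound: "0 \<le> the_prop (p c) s \<and> the_prop (p c) s \<le> 1" if "c \<in> C" for c s
    using Prop.prems(1)[OF that] by (auto simp: unit_val_def)
  have "\<exists>l. ((\<lambda>i. the_prop (p i) s) \<longlongrightarrow> l) ?G" for s
    using Prop.prems(2) bound by (intro chain_filter_convergent[OF C]) (auto simp: le_fun_def)
  then obtain l where l: "\<And>s. ((\<lambda>i. the_prop (p i) s) \<longlongrightarrow> l s) ?G" by metis
  have "0 \<le> l s" for s
    by (rule tendsto_lowerbound[OF l _ nbot]) (use bound C(1) in \<open>auto simp: ev\<close>)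
  moreover have "l s \<le> 1" for s
    by (rule tendsto_upperbound[OF l _ nbot]) (use bound C(1) in \<open>auto simp: ev\<close>)
  ultimately show ?case using l by (intro bexI[of _ "VProp l"]) (auto simp: unit_val_def)
next
  case (PropTo \<tau>)
  let ?G = "chain_filter r C"
  note ev = eventually_chain_filter[OF C]
  have nbot: "?G \<noteq> bot" using C(1,2) unfolding trivial_limit_def ev by blast
  have "\<exists>l\<in>dom_ty \<tau>. conv_val \<tau> ?G (\<lambda>i. the_fun (p i) v) l" if "v \<in> unit_val" for v
    using PropTo.prems that by (intro PropTo.IH) (auto intro!: the_fun_in_dom_ty)
  then obtain l where l: "\<And>v. v \<in> unit_val \<Longrightarrow> l v \<in> dom_ty \<tau>"
    "\<And>v. v \<in> unit_val \<Longrightarrow> conv_val \<tau> ?G (\<lambda>i. the_fun (p i) v) (l v)" by metis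
  have "le_val \<tau> (l u) (l v)" if "u \<in> unit_val" "v \<in> unit_val" "u \<le> v" for u v
  proof (rule conv_val_le[OF nbot l(2)[OF that(1)] l(2)[OF that(2)]])
    show "\<forall>\<^sub>F i in ?G. le_val \<tau> (the_fun (p i) u) (the_fun (p i) v)"
      unfolding ev using C(1) PropTo.prems(1) that by (blast intro: the_fun_mono)
  qed
  then show ?case using l by (intro bexI[of _ "VFun (\<lambda>v\<in>unit_val. l v)"]) auto
qed


section \<open>Fixpoints\<close>

text \<open>Limits are restricted to \<open>dom_ty \<tau>\<close> because \<open>conv_val\<close>
  sees neither arguments outside \<open>unit_val\<close> nor constructors, and so does not determine
  the limit by itself.\<close>

definition limit_closed :: "ty \<Rightarrow> 's val set \<Rightarrow> bool" where
  "limit_closed \<tau> K \<longleftrightarrow> (\<forall>G l. G \<noteq> bot \<longrightarrow> (\<forall>\<^sub>F d in G. d \<in> K) \<longrightarrow>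
     conv_val \<tau> G (\<lambda>d. d) l \<longrightarrow> l \<in> dom_ty \<tau> \<longrightarrow> l \<in> K)"

text \<open>The limit of the chain is its least upper bound: every member lies below its own tail,
  and inequalities survive the limit. Closedness keeps this bound in \<open>K\<close>.\<close>

lemma chain_sup_exists:
  assumes r: "val_order \<tau> r" and K: "K \<subseteq> dom_ty \<tau>" "limit_closed \<tau> K"
    and C: "C \<subseteq> K" "C \<noteq> {}" "\<forall>c\<in>C. \<forall>d\<in>C. r c d \<or> r d c"
  shows "\<exists>u\<in>K. (\<forall>c\<in>C. r c u) \<and> (\<forall>b. (\<forall>c\<in>C. r c b) \<longrightarrow> r u b)"
proof -
  let ?G = "chain_filter r C"
  note trans = val_order_transp[OF r]
  note ev = eventually_chain_filter[OF C(2,3) trans]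
  have nbot: "?G \<noteq> bot" using C(2,3) unfolding trivial_limit_def ev by blast
  have "\<exists>l\<in>dom_ty \<tau>. conv_val \<tau> ?G (\<lambda>d. d) l"
    using C(1) K(1) r by (intro chain_limit_exists[OF C(2,3) trans]) (auto simp: val_order_def)
  then obtain l where l: "l \<in> dom_ty \<tau>" "conv_val \<tau> ?G (\<lambda>d. d) l" by blast
  \<comment> \<open>For the converse order the two limits exchange their roles.\<close>
  have lim: "r a b" if "conv_val \<tau> ?G p a" "conv_val \<tau> ?G q b" "\<forall>\<^sub>F d in ?G. r (p d) (q d)"
    for a b p q
    using r conv_val_le[OF nbot that(1,2)] conv_val_le[OF nbot that(2,1)] that(3)
    by (auto simp: val_order_def)
  have "\<forall>\<^sub>F d in ?G. d \<in> K" using C(1,2) unfolding ev by blast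
  then have "l \<in> K" using K(2) nbot l unfolding limit_closed_def by blast
  moreover have "r c l" if "c \<in> C" for c
    by (rule lim[OF conv_val_const l(2)]) (use that in \<open>auto simp: ev\<close>)
  moreover have "r l b" if "\<forall>c\<in>C. r c b" for b
    by (rule lim[OF l(2) conv_val_const]) (use that C(2) in \<open>auto simp: ev\<close>)
  ultimately show ?thesis by blast
qed

text \<open>
  Zorn's lemma replaces the transfinite iteration from \<open>b\<close>: it is applied to the elements of
  \<open>K\<close> that lie below both their image and all pre-fixpoints, and \<open>F\<close> fixes a maximal one.
\<close>

lemma fixpoint_exists:
  assumes r: "val_order \<tau> r" and K: "K \<subseteq> dom_ty \<tau>" "limit_closed \<tau> K"
    and b: "b \<in> K" "\<And>d. d \<in> dom_ty \<tau> \<Longrightarrow> r b d"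
    and F: "\<And>d. d \<in> dom_ty \<tau> \<Longrightarrow> F d \<in> dom_ty \<tau>" "\<And>d. d \<in> K \<Longrightarrow> F d \<in> K"
    and mono: "\<And>d e. d \<in> dom_ty \<tau> \<Longrightarrow> e \<in> dom_ty \<tau> \<Longrightarrow> r d e \<Longrightarrow> r (F d) (F e)"
  shows "\<exists>d\<in>K. F d = d \<and> (\<forall>e\<in>dom_ty \<tau>. r (F e) e \<longrightarrow> r d e)"
proof -
  note refl = val_order_refl[OF r] and trans = transpD[OF val_order_transp[OF r]]
    and antisym = val_order_antisym[OF r]
  \<comment> \<open>The last condition ensures that a fixpoint found inside \<open>K\<close> is
    least in all of \<open>dom_ty \<tau>\<close>, where \<open>least_fix\<close> measures
    leastness.\<close>
  define A where "A = {d \<in> K. r d (F d) \<and> (\<forall>e\<in>dom_ty \<tau>. r (F e) e \<longrightarrow> r d e)}"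
  have AK: "A \<subseteq> K" by (auto simp: A_def)
  have "partial_order_on A (relation_of r A)"
    using AK K(1) by (intro partial_order_on_relation_ofI) (blast intro: refl trans antisym)+
  moreover have "\<exists>u\<in>A. \<forall>a\<in>C. r a u" if C: "C \<in> Chains (relation_of r A)" for C
  proof (cases "C = {}")
    case True
    have "b \<in> A" using b F K(1) by (auto simp: A_def)
    then show ?thesis using True by blast
  next
    case False
    have CA: "C \<subseteq> A" and tot: "\<forall>c\<in>C. \<forall>d\<in>C. r c d \<or> r d c"
      using C by (auto simp: Chains_def relation_of_def)
    have CK: "C \<subseteq> K" using CA AK by blast
    obtain u where u: "u \<in> K" "\<And>c. c \<in> C \<Longrightarrow> r c u" "\<And>b. (\<forall>c\<in>C. r c b) \<Longrightarrow> r u b"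
      using chain_sup_exists[OF r K CK False tot] by blast
    \<comment> \<open>\<open>F u\<close> also bounds the chain, so the least bound \<open>u\<close>
      lies below \<open>F u\<close>.\<close>
    have "r c (F u)" if "c \<in> C" for c
    proof (rule trans)
      show "r c (F c)" using that CA by (auto simp: A_def)
      show "r (F c) (F u)" using that CK K(1) u by (intro mono) auto
    qed
    then have "r u (F u)" by (intro u(3)) blast
    moreover have "r u e" if "e \<in> dom_ty \<tau>" "r (F e) e" for e
      using that CA by (intro u(3)) (auto simp: A_def)
    ultimately have "u \<in> A" using u(1) by (auto simp: A_def)
    then show ?thesis using u(2) by blast
  qed
  ultimately obtain m where m: "m \<in> A" "\<And>a. a \<in> A \<Longrightarrow> r m a \<Longrightarrow> a = m"
    using predicate_Zorn[of A r] by blast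
  have mK: "m \<in> K" "m \<in> dom_ty \<tau>" "r m (F m)" "\<And>e. e \<in> dom_ty \<tau> \<Longrightarrow> r (F e) e \<Longrightarrow> r m e"
    using m(1) K(1) by (auto simp: A_def)
  have "r (F m) e" if e: "e \<in> dom_ty \<tau>" "r (F e) e" for e
    using trans[OF mono[OF mK(2) e(1) mK(4)[OF e]] e(2)] .
  moreover have "r (F m) (F (F m))" using mK F by (intro mono) auto
  ultimately have "F m \<in> A" using F(2)[OF mK(1)] by (auto simp: A_def)
  then have "F m = m" using m(2) mK(3) by blast
  then show ?thesis using mK by blast
qed

text \<open>\<open>least_fix\<close> does not mention \<open>K\<close>, so any admissible
  \<open>K\<close> locates the same value: \<open>dom_ty\<close> for simple typing,
  \<open>dom_rty\<close> for refined typing. Leastness is stated among pre-fixpoints, which is what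
  comparing the fixpoints of two operators requires.\<close>

lemma least_fix_spec:
  fixes F :: "'s val \<Rightarrow> 's val"
  assumes K: "K \<subseteq> dom_ty \<tau>" "limit_closed \<tau> K" "const_val 0 \<tau> \<in> K"
    and F: "\<And>d. d \<in> dom_ty \<tau> \<Longrightarrow> F d \<in> dom_ty \<tau>" "\<And>d. d \<in> K \<Longrightarrow> F d \<in> K"
    and mono: "\<And>d e. d \<in> dom_ty \<tau> \<Longrightarrow> e \<in> dom_ty \<tau> \<Longrightarrow> le_val \<tau> d e \<Longrightarrow> le_val \<tau> (F d) (F e)"
  shows "least_fix \<tau> F \<in> K \<and> F (least_fix \<tau> F) = least_fix \<tau> F \<and>
    (\<forall>e\<in>dom_ty \<tau>. le_val \<tau> (F e) e \<longrightarrow> le_val \<tau> (least_fix \<tau> F) e)"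
proof -
  have "\<exists>d\<in>K. F d = d \<and> (\<forall>e\<in>dom_ty \<tau>. le_val \<tau> (F e) e \<longrightarrow> le_val \<tau> d e)"
    by (rule fixpoint_exists[where r = "le_val \<tau>"])
      (use assms in \<open>auto simp: val_order_def const_val_0_least\<close>)
  then obtain d
    where d: "d \<in> K" "F d = d" "\<forall>e\<in>dom_ty \<tau>. le_val \<tau> (F e) e \<longrightarrow> le_val \<tau> d e" by blast
  have "least_fix \<tau> F = d"
    unfolding least_fix_def
  proof (rule the_equality)
    show "d \<in> dom_ty \<tau> \<and> F d = d \<and> (\<forall>e\<in>dom_ty \<tau>. F e = e \<longrightarrow> le_val \<tau> d e)"
      using d K(1) by (auto simp: le_val_refl)
  next
    fix d' assume "d' \<in> dom_ty \<tau> \<and> F d' = d' \<and> (\<forall>e\<in>dom_ty \<tau>. F e = e \<longrightarrow> le_val \<tau> d' e)"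
    then show "d' = d" using d K(1) by (intro le_val_antisym[of d' \<tau> d]) (auto simp: le_val_refl)
  qed
  then show ?thesis using d by simp
qed

lemma greatest_fix_spec:
  fixes F :: "'s val \<Rightarrow> 's val"
  assumes K: "K \<subseteq> dom_ty \<tau>" "limit_closed \<tau> K" "const_val 1 \<tau> \<in> K"
    and F: "\<And>d. d \<in> dom_ty \<tau> \<Longrightarrow> F d \<in> dom_ty \<tau>" "\<And>d. d \<in> K \<Longrightarrow> F d \<in> K"
    and mono: "\<And>d e. d \<in> dom_ty \<tau> \<Longrightarrow> e \<in> dom_ty \<tau> \<Longrightarrow> le_val \<tau> d e \<Longrightarrow> le_val \<tau> (F d) (F e)"
  shows "greatest_fix \<tau> F \<in> K \<and> F (greatest_fix \<tau> F) = greatest_fix \<tau> F \<and>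
    (\<forall>e\<in>dom_ty \<tau>. le_val \<tau> e (F e) \<longrightarrow> le_val \<tau> e (greatest_fix \<tau> F))"
proof -
  have "\<exists>d\<in>K. F d = d \<and> (\<forall>e\<in>dom_ty \<tau>. le_val \<tau> e (F e) \<longrightarrow> le_val \<tau> e d)"
    by (rule fixpoint_exists[where r = "\<lambda>d e. le_val \<tau> e d"])
      (use assms in \<open>auto simp: val_order_def const_val_1_greatest\<close>)
  then obtain d
    where d: "d \<in> K" "F d = d" "\<forall>e\<in>dom_ty \<tau>. le_val \<tau> e (F e) \<longrightarrow> le_val \<tau> e d" by blast
  have "greatest_fix \<tau> F = d"
    unfolding greatest_fix_def
  proof (rule the_equality)
    show "d \<in> dom_ty \<tau> \<and> F d = d \<and> (\<forall>e\<in>dom_ty \<tau>. F e = e \<longrightarrow> le_val \<tau> e d)"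
      using d K(1) by (auto simp: le_val_refl)
  next
    fix d' assume "d' \<in> dom_ty \<tau> \<and> F d' = d' \<and> (\<forall>e\<in>dom_ty \<tau>. F e = e \<longrightarrow> le_val \<tau> e d')"
    then show "d' = d" using d K(1) by (intro le_val_antisym[of d' \<tau> d]) (auto simp: le_val_refl)
  qed
  then show ?thesis using d by simp
qed


section \<open>Soundness of simple typing\<close>

text \<open>Membership and order in one relation: abstractions and fixpoints lie in the domain only
  if their bodies are monotone, so both properties have to be proved in a single induction.\<close>

definition dom_le :: "ty \<Rightarrow> 's val \<Rightarrow> 's val \<Rightarrow> bool" where
  "dom_le \<tau> d e \<longleftrightarrow> d \<in> dom_ty \<tau> \<and> e \<in> dom_ty \<tau> \<and> le_val \<tau> d e"

lemma dom_le_refl: "dom_le \<tau> d d \<longleftrightarrow> d \<in> dom_ty \<tau>"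
  by (simp add: dom_le_def le_val_refl)

lemma dom_le_Prop:
  "dom_le Prop (VProp u) (VProp v) \<longleftrightarrow> (\<forall>s. 0 \<le> u s \<and> u s \<le> v s \<and> v s \<le> 1)"
  unfolding dom_le_def dom_ty.simps le_val.simps unit_val_def le_fun_def
  by (auto intro: order_trans)

lemma dom_le_PropE:
  assumes "dom_le Prop d e"
  obtains u v where "d = VProp u" "e = VProp v" "\<And>s. 0 \<le> u s" "\<And>s. u s \<le> v s" "\<And>s. v s \<le> 1"
  using assms by (auto simp: dom_le_def unit_val_def le_fun_def)

section \<open>Successors, expectations and thresholds\<close>

lemma succs_nonempty:
  assumes "markov_chain M"
  shows "succs M s \<noteq> {}"
proof
  assume "succs M s = {}"
  then have "trans M s t \<le> 0" for t by (auto simp: succs_def not_less)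
  then have "(\<Sum>t\<in>UNIV. trans M s t) \<le> 0" by (simp add: sum_nonpos)
  then show False using assms by (simp add: markov_chain_def)
qed

text \<open>Transitions of probability 0 contribute nothing, and the remaining weights sum to
  1.\<close>

lemma expectation_const:
  assumes "markov_chain M" and "\<And>t. trans M s t > 0 \<Longrightarrow> v t = c"
  shows "(\<Sum>t\<in>UNIV. trans M s t * v t) = c"
proof -
  have "trans M s t * v t = trans M s t * c" for t
    using assms by (cases "trans M s t = 0") (auto simp: markov_chain_def less_le)
  then have "(\<Sum>t\<in>UNIV. trans M s t * v t) = (\<Sum>t\<in>UNIV. trans M s t * c)" by (intro sum.cong) auto
  then show ?thesis using assms(1) by (simp add: markov_chain_def flip: sum_distrib_right)
qed

lemma expectation_le:
  assumes "markov_chain M" and "\<And>t. u t \<le> v t"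
  shows "(\<Sum>t\<in>UNIV. trans M s t * u t) \<le> (\<Sum>t\<in>UNIV. trans M s t * v t)"
  using assms by (auto simp: markov_chain_def intro!: sum_mono mult_left_mono)

lemma in_threshold_mono: "in_threshold a J \<Longrightarrow> a \<le> b \<Longrightarrow> in_threshold b J"
  by (cases J) auto

section \<open>Monotone dependence of fixpoints on the operator\<close>

lemma limit_closed_dom_ty: "limit_closed \<tau> (dom_ty \<tau>)"
  by (simp add: limit_closed_def)

lemma dom_le_fun_in_dom_ty:
  "(\<And>d e. dom_le \<tau> d e \<Longrightarrow> dom_le \<tau> (F d) (F e)) \<Longrightarrow> d \<in> dom_ty \<tau> \<Longrightarrow> F d \<in> dom_ty \<tau>"
  by (simp flip: dom_le_refl)

text \<open>The least fixpoint of F' is a pre-fixpoint of F, because F lies below F'.\<close>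

lemma dom_le_least_fix:
  assumes F: "\<And>d e. dom_le \<tau> d e \<Longrightarrow> dom_le \<tau> (F d) (F e)"
    and F': "\<And>d e. dom_le \<tau> d e \<Longrightarrow> dom_le \<tau> (F' d) (F' e)"
    and FF': "\<And>d. d \<in> dom_ty \<tau> \<Longrightarrow> dom_le \<tau> (F d) (F' d)"
  shows "dom_le \<tau> (least_fix \<tau> F) (least_fix \<tau> F')"
proof -
  note spec = least_fix_spec[OF order_refl limit_closed_dom_ty const_val_in_dom_ty[of 0]]
  have 1: "least_fix \<tau> F \<in> dom_ty \<tau> \<and> F (least_fix \<tau> F) = least_fix \<tau> F \<and>
    (\<forall>e\<in>dom_ty \<tau>. le_val \<tau> (F e) e \<longrightarrow> le_val \<tau> (least_fix \<tau> F) e)"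
    using F dom_le_fun_in_dom_ty[OF F] by (intro spec) (simp_all add: dom_le_def)
  have 2: "least_fix \<tau> F' \<in> dom_ty \<tau> \<and> F' (least_fix \<tau> F') = least_fix \<tau> F' \<and>
    (\<forall>e\<in>dom_ty \<tau>. le_val \<tau> (F' e) e \<longrightarrow> le_val \<tau> (least_fix \<tau> F') e)"
    using F' dom_le_fun_in_dom_ty[OF F'] by (intro spec) (simp_all add: dom_le_def)
  show ?thesis using 1 2 FF'[of "least_fix \<tau> F'"] by (auto simp: dom_le_def)
qed

text \<open>Dually, the greatest fixpoint of F is a post-fixpoint of F'.\<close>

lemma dom_le_greatest_fix:
  assumes F: "\<And>d e. dom_le \<tau> d e \<Longrightarrow> dom_le \<tau> (F d) (F e)"
    and F': "\<And>d e. dom_le \<tau> d e \<Longrightarrow> dom_le \<tau> (F' d) (F' e)"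
    and FF': "\<And>d. d \<in> dom_ty \<tau> \<Longrightarrow> dom_le \<tau> (F d) (F' d)"
  shows "dom_le \<tau> (greatest_fix \<tau> F) (greatest_fix \<tau> F')"
proof -
  note spec = greatest_fix_spec[OF order_refl limit_closed_dom_ty const_val_in_dom_ty[of 1]]
  have 1: "greatest_fix \<tau> F \<in> dom_ty \<tau> \<and> F (greatest_fix \<tau> F) = greatest_fix \<tau> F \<and>
    (\<forall>e\<in>dom_ty \<tau>. le_val \<tau> e (F e) \<longrightarrow> le_val \<tau> e (greatest_fix \<tau> F))"
    using F dom_le_fun_in_dom_ty[OF F] by (intro spec) (simp_all add: dom_le_def)
  have 2: "greatest_fix \<tau> F' \<in> dom_ty \<tau> \<and> F' (greatest_fix \<tau> F') = greatest_fix \<tau> F' \<and>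
    (\<forall>e\<in>dom_ty \<tau>. le_val \<tau> e (F' e) \<longrightarrow> le_val \<tau> e (greatest_fix \<tau> F'))"
    using F' dom_le_fun_in_dom_ty[OF F'] by (intro spec) (simp_all add: dom_le_def)
  show ?thesis using 1 2 FF'[of "greatest_fix \<tau> F"] by (auto simp: dom_le_def)
qed

definition env_le :: "('x \<rightharpoonup> ty) \<Rightarrow> ('x \<Rightarrow> 's val) \<Rightarrow> ('x \<Rightarrow> 's val) \<Rightarrow> bool" where
  "env_le \<Gamma> \<eta> \<eta>' \<longleftrightarrow> (\<forall>X \<sigma>. \<Gamma> X = Some \<sigma> \<longrightarrow> dom_le \<sigma> (\<eta> X) (\<eta>' X))"

lemma env_le_refl1: "env_le \<Gamma> \<eta> \<eta>' \<Longrightarrow> env_le \<Gamma> \<eta> \<eta>"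
  and env_le_refl2: "env_le \<Gamma> \<eta> \<eta>' \<Longrightarrow> env_le \<Gamma> \<eta>' \<eta>'"
  by (auto simp: env_le_def dom_le_def le_val_refl)

lemma env_le_upd:
  "env_le \<Gamma> \<eta> \<eta>' \<Longrightarrow> dom_le \<sigma> d d' \<Longrightarrow> env_le (\<Gamma>(X \<mapsto> \<sigma>)) (\<eta>(X := d)) (\<eta>'(X := d'))"
  by (auto simp: env_le_def)

text \<open>A binary logical relation: taking \<eta>' = \<eta> gives membership in the domain, and
  two environments give monotonicity.\<close>

lemma simply_typed_sound:
  assumes "markov_chain M" "simply_typed \<Gamma> \<phi> \<tau>"
  shows "env_le \<Gamma> \<eta> \<eta>' \<Longrightarrow> dom_le \<tau> (sem M \<phi> \<tau> \<eta>) (sem M \<phi> \<tau> \<eta>')"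
  using assms(2)
proof (induction arbitrary: \<eta> \<eta>' rule: simply_typed.induct)
  case (1 \<Gamma> p)
  then show ?case by (simp add: dom_le_Prop)
next
  case (2 \<Gamma> X \<tau>)
  then show ?case by (simp add: env_le_def)
next
  case (3 \<Gamma> \<phi> \<psi>)
  from 3(3)[OF 3(5)] obtain u v where
    "sem M \<phi> Prop \<eta> = VProp u" "sem M \<phi> Prop \<eta>' = VProp v"
    "\<And>s. 0 \<le> u s" "\<And>s. u s \<le> v s" "\<And>s. v s \<le> 1" by (erule dom_le_PropE)
  moreover from 3(4)[OF 3(5)] obtain u' v' where
    "sem M \<psi> Prop \<eta> = VProp u'" "sem M \<psi> Prop \<eta>' = VProp v'"
    "\<And>s. 0 \<le> u' s" "\<And>s. u' s \<le> v' s" "\<And>s. v' s \<le> 1" by (erule dom_le_PropE)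
  moreover from calculation have "max (u s) (u' s) \<le> max (v s) (v' s)" for s
    by (intro max.mono)
  ultimately show ?case by (simp add: dom_le_Prop max.coboundedI1)
next
  case (4 \<Gamma> \<phi> \<psi>)
  from 4(3)[OF 4(5)] obtain u v where
    "sem M \<phi> Prop \<eta> = VProp u" "sem M \<phi> Prop \<eta>' = VProp v"
    "\<And>s. 0 \<le> u s" "\<And>s. u s \<le> v s" "\<And>s. v s \<le> 1" by (erule dom_le_PropE)
  moreover from 4(4)[OF 4(5)] obtain u' v' where
    "sem M \<psi> Prop \<eta> = VProp u'" "sem M \<psi> Prop \<eta>' = VProp v'"
    "\<And>s. 0 \<le> u' s" "\<And>s. u' s \<le> v' s" "\<And>s. v' s \<le> 1" by (erule dom_le_PropE)
  moreover from calculation have "min (u s) (u' s) \<le> min (v s) (v' s)" for s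
    by (intro min.mono)
  ultimately show ?case by (simp add: dom_le_Prop min.coboundedI1)
next
  case (5 \<Gamma> \<phi> J)
  from 5(2)[OF 5(3)] show ?case
    by (rule dom_le_PropE) (auto simp: dom_le_Prop dest: in_threshold_mono)
next
  case (6 \<Gamma> \<phi>)
  from 6(2)[OF 6(3)] obtain u v where uv:
    "sem M \<phi> Prop \<eta> = VProp u" "sem M \<phi> Prop \<eta>' = VProp v"
    "\<And>s. 0 \<le> u s" "\<And>s. u s \<le> v s" "\<And>s. v s \<le> 1" by (erule dom_le_PropE)
  have ne: "succs M s \<noteq> {}" for s by (rule succs_nonempty[OF assms(1)])
  have "0 \<le> Min (u ` succs M s)" for s using ne uv by simp
  moreover have "Min (u ` succs M s) \<le> Min (v ` succs M s)" for s
    using ne by (intro Min.boundedI) (auto intro: order_trans[OF Min_le uv(4)])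
  moreover have "Min (v ` succs M s) \<le> 1" for s
    using ne[of s] uv by (auto simp: Min_le_iff)
  ultimately show ?case using uv(1,2) by (simp add: dom_le_Prop)
next
  case (7 \<Gamma> \<phi>)
  from 7(2)[OF 7(3)] obtain u v where uv:
    "sem M \<phi> Prop \<eta> = VProp u" "sem M \<phi> Prop \<eta>' = VProp v"
    "\<And>s. 0 \<le> u s" "\<And>s. u s \<le> v s" "\<And>s. v s \<le> 1" by (erule dom_le_PropE)
  have ne: "succs M s \<noteq> {}" for s by (rule succs_nonempty[OF assms(1)])
  have "0 \<le> Max (u ` succs M s)" for s using ne[of s] uv by (auto simp: Max_ge_iff)
  moreover have "Max (u ` succs M s) \<le> Max (v ` succs M s)" for s
    using ne by (intro Max.boundedI) (auto intro: order_trans[OF uv(4) Max_ge])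
  moreover have "Max (v ` succs M s) \<le> 1" for s using ne uv by simp
  ultimately show ?case using uv(1,2) by (simp add: dom_le_Prop)
next
  case (8 \<Gamma> \<phi>)
  from 8(2)[OF 8(3)] obtain u v where uv:
    "sem M \<phi> Prop \<eta> = VProp u" "sem M \<phi> Prop \<eta>' = VProp v"
    "\<And>s. 0 \<le> u s" "\<And>s. u s \<le> v s" "\<And>s. v s \<le> 1" by (erule dom_le_PropE)
  have "(\<Sum>t\<in>UNIV. trans M s t * v t) \<le> 1" for s
    using expectation_le[OF assms(1), of v "\<lambda>_. 1" s] expectation_const[OF assms(1), of s "\<lambda>_. 1" 1]
      uv(5) by simp
  moreover have "0 \<le> (\<Sum>t\<in>UNIV. trans M s t * u t)" for s
    using expectation_le[OF assms(1), of "\<lambda>_. 0" u s] uv(3) by simp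
  ultimately show ?case using uv expectation_le[OF assms(1), of u v] by (simp add: dom_le_Prop)
next
  case (9 \<Gamma> X \<tau> \<phi>)
  \<comment> \<open>Both environments are left arbitrary: the instances (\<eta>, \<eta>), (\<eta>',
    \<eta>') and (\<eta>, \<eta>') yield monotonicity of the two operators and their
    comparison.\<close>
  have *: "dom_le \<tau> (sem M \<phi> \<tau> (\<eta>1(X := d))) (sem M \<phi> \<tau> (\<eta>2(X := e)))"
    if "env_le \<Gamma> \<eta>1 \<eta>2" "dom_le \<tau> d e" for \<eta>1 \<eta>2 d e
    using 9(2)[OF env_le_upd[OF that]] .
  show ?case unfolding sem.simps
    by (rule dom_le_least_fix; rule *)
      (simp_all add: dom_le_refl 9(3) env_le_refl1[OF 9(3)] env_le_refl2[OF 9(3)])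
next
  case (10 \<Gamma> X \<tau> \<phi>)
  have *: "dom_le \<tau> (sem M \<phi> \<tau> (\<eta>1(X := d))) (sem M \<phi> \<tau> (\<eta>2(X := e)))"
    if "env_le \<Gamma> \<eta>1 \<eta>2" "dom_le \<tau> d e" for \<eta>1 \<eta>2 d e
    using 10(2)[OF env_le_upd[OF that]] .
  show ?case unfolding sem.simps
    by (rule dom_le_greatest_fix; rule *)
      (simp_all add: dom_le_refl 10(3) env_le_refl1[OF 10(3)] env_le_refl2[OF 10(3)])
next
  case (11 \<Gamma> X \<phi> \<tau>)
  have *: "dom_le \<tau> (sem M \<phi> \<tau> (\<eta>1(X := VProp u))) (sem M \<phi> \<tau> (\<eta>2(X := VProp v)))"
    if "env_le \<Gamma> \<eta>1 \<eta>2" "u \<in> unit_val" "v \<in> unit_val" "u \<le> v" for \<eta>1 \<eta>2 u v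
    using that by (intro 11(2) env_le_upd) (auto simp: dom_le_def)
  have "sem M (Lam X \<phi>) (PropTo \<tau>) \<eta>0 \<in> dom_ty (PropTo \<tau>)" if "env_le \<Gamma> \<eta>0 \<eta>0" for \<eta>0
  proof -
    have "sem M \<phi> \<tau> (\<eta>0(X := VProp v)) \<in> dom_ty \<tau>" if "v \<in> unit_val" for v
      using *[OF \<open>env_le \<Gamma> \<eta>0 \<eta>0\<close> that that] by (simp add: dom_le_def)
    moreover have "le_val \<tau> (sem M \<phi> \<tau> (\<eta>0(X := VProp u))) (sem M \<phi> \<tau> (\<eta>0(X := VProp v)))"
      if "u \<in> unit_val" "v \<in> unit_val" "u \<le> v" for u v
      using *[OF \<open>env_le \<Gamma> \<eta>0 \<eta>0\<close> that] by (simp add: dom_le_def)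
    ultimately show ?thesis by simp
  qed
  moreover have "le_val (PropTo \<tau>) (sem M (Lam X \<phi>) (PropTo \<tau>) \<eta>) (sem M (Lam X \<phi>) (PropTo \<tau>) \<eta>')"
    using *[OF 11(3)] by (simp add: dom_le_def)
  ultimately show ?case
    unfolding dom_le_def using env_le_refl1[OF 11(3)] env_le_refl2[OF 11(3)] by blast
next
  case (12 \<Gamma> \<phi> \<tau> \<psi>)
  let ?f = "sem M \<phi> (PropTo \<tau>) \<eta>" and ?g = "sem M \<phi> (PropTo \<tau>) \<eta>'"
  have fg: "?f \<in> dom_ty (PropTo \<tau>)" "?g \<in> dom_ty (PropTo \<tau>)" "le_val (PropTo \<tau>) ?f ?g"
    using 12(3)[OF 12(5)] by (simp_all only: dom_le_def)
  from 12(4)[OF 12(5)] obtain u v where uv: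
    "sem M \<psi> Prop \<eta> = VProp u" "sem M \<psi> Prop \<eta>' = VProp v"
    "u \<in> unit_val" "v \<in> unit_val" "u \<le> v" by (auto simp: dom_le_def)
  \<comment> \<open>Passes through f v: the argument grows first, then the function.\<close>
  have "le_val \<tau> (the_fun ?f u) (the_fun ?g v)"
    using fg(3) uv(4) by (intro le_val_trans[OF the_fun_mono[OF fg(1) uv(3-5)]]) simp
  then show ?case
    using the_fun_in_dom_ty[OF fg(1) uv(3)] the_fun_in_dom_ty[OF fg(2) uv(4)] uv(1,2)
    by (simp only: dom_le_def sem.simps val.sel)
qed

text \<open>Serves the weakening rule, where the value of the added variable must be
  irrelevant.\<close>

lemma sem_cong:
  "simply_typed \<Gamma> \<phi> \<tau> \<Longrightarrow> \<forall>X\<in>dom \<Gamma>. \<eta> X = \<eta>' X \<Longrightarrow> sem M \<phi> \<tau> \<eta> = sem M \<phi> \<tau> \<eta>'"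
proof (induction arbitrary: \<eta> \<eta>' rule: simply_typed.induct)
  case (2 \<Gamma> X \<tau>)
  then show ?case by (simp add: dom_def)
next
  case (3 \<Gamma> \<phi> \<psi>)
  show ?case using 3(3)[OF 3(5)] 3(4)[OF 3(5)] by simp
next
  case (4 \<Gamma> \<phi> \<psi>)
  show ?case using 4(3)[OF 4(5)] 4(4)[OF 4(5)] by simp
next
  case (5 \<Gamma> \<phi> J)
  show ?case using 5(2)[OF 5(3)] by simp
next
  case (6 \<Gamma> \<phi>)
  show ?case using 6(2)[OF 6(3)] by simp
next
  case (7 \<Gamma> \<phi>)
  show ?case using 7(2)[OF 7(3)] by simp
next
  case (8 \<Gamma> \<phi>)
  show ?case using 8(2)[OF 8(3)] by simp
next
  case (9 \<Gamma> X \<tau> \<phi>)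
  have "sem M \<phi> \<tau> (\<eta>(X := d)) = sem M \<phi> \<tau> (\<eta>'(X := d))" for d
    using 9(3) by (intro 9(2)) auto
  then show ?case by simp
next
  case (10 \<Gamma> X \<tau> \<phi>)
  have "sem M \<phi> \<tau> (\<eta>(X := d)) = sem M \<phi> \<tau> (\<eta>'(X := d))" for d
    using 10(3) by (intro 10(2)) auto
  then show ?case by simp
next
  case (11 \<Gamma> X \<phi> \<tau>)
  have "sem M \<phi> \<tau> (\<eta>(X := d)) = sem M \<phi> \<tau> (\<eta>'(X := d))" for d
    using 11(3) by (intro 11(2)) auto
  then show ?case by (simp cong: restrict_cong)
next
  case (12 \<Gamma> \<phi> \<tau> \<psi>)
  show ?case using 12(3)[OF 12(5)] 12(4)[OF 12(5)] by simp
qed simp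

lemma simply_typed_weaken: "simply_typed \<Gamma> \<phi> \<tau> \<Longrightarrow> \<Gamma> \<subseteq>\<^sub>m \<Gamma>' \<Longrightarrow> simply_typed \<Gamma>' \<phi> \<tau>"
proof (induction arbitrary: \<Gamma>' rule: simply_typed.induct)
  case (2 \<Gamma> X \<tau>)
  then show ?case by (intro simply_typed.intros) (metis domI map_le_def)
qed (blast intro: simply_typed.intros map_le_upd)+


section \<open>Refined types as affine maps\<close>

definition mix :: "real \<Rightarrow> ('s \<Rightarrow> real) \<Rightarrow> ('s \<Rightarrow> real) \<Rightarrow> 's \<Rightarrow> real" where
  "mix a u v = (\<lambda>s. a * u s + (1 - a) * v s)"

lemma mix_self [simp]: "mix a v v = v"
  by (simp add: mix_def fun_eq_iff algebra_simps)

lemma map2_mix_self: "map2 (mix a) us us = us"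
  by (induction us) auto

lemma mix_in_prop_set:
  assumes "0 \<le> a" "a \<le> 1" "u \<in> prop_set TU" "v \<in> prop_set TU"
  shows "mix a u v \<in> prop_set TU"
proof -
  have "0 \<le> mix a u v s \<and> mix a u v s \<le> 1" for s
    using assms convex_bound_le[of "u s" 1 "v s" a "1 - a"]
    by (auto simp: mix_def prop_set_def unit_val_def)
  then show ?thesis using assms(3,4) by (auto simp: prop_set_def unit_val_def mix_def)
qed

lemma prop_set_unit_val: "v \<in> prop_set TU \<Longrightarrow> v \<in> unit_val"
  by (simp add: prop_set_def)

text \<open>
  Preservation of convex combinations as a ternary logical relation, so that it can be proved by
  induction on derivations: the three values belong to a mixture of two environments and to these
  two environments themselves.
\<close>

primrec affine_rel :: "real \<Rightarrow> 's rty \<Rightarrow> 's val \<Rightarrow> 's val \<Rightarrow> 's val \<Rightarrow> bool" where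
  "affine_rel a (RProp T U) d d1 d2 \<longleftrightarrow>
     d1 \<in> VProp ` prop_set (T, U) \<and> d2 \<in> VProp ` prop_set (T, U) \<and>
     d = VProp (mix a (the_prop d1) (the_prop d2))"
| "affine_rel a (RFun T U \<kappa>) d d1 d2 \<longleftrightarrow>
     (\<forall>u\<in>prop_set (T, U). \<forall>v\<in>prop_set (T, U).
        affine_rel a \<kappa> (the_fun d (mix a u v)) (the_fun d1 u) (the_fun d2 v))"

lemma affine_rel_RProp:
  "affine_rel a (RProp T U) (VProp w) (VProp u) (VProp v) \<longleftrightarrow>
     u \<in> prop_set (T, U) \<and> v \<in> prop_set (T, U) \<and> w = mix a u v"
  by auto

lemma affine_rel_RPropE:
  assumes "affine_rel a (RProp T U) d d1 d2"
  obtains u v where "d = VProp (mix a u v)" "d1 = VProp u" "d2 = VProp v"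
    "u \<in> prop_set (T, U)" "v \<in> prop_set (T, U)"
  using assms by auto

lemma in_arg_set_RProp: "vs \<in> arg_set (RProp T U) \<longleftrightarrow> vs = []"
  by (simp add: arg_set_def)

lemma in_arg_set_RFun:
  "vs \<in> arg_set (RFun T U \<kappa>) \<longleftrightarrow> (\<exists>v ws. vs = v # ws \<and> v \<in> prop_set (T, U) \<and> ws \<in> arg_set \<kappa>)"
  by (auto simp: arg_set_def list_all2_Cons2)

lemma ball_arg_set_RFun:
  "(\<forall>vs\<in>arg_set (RFun T U \<kappa>). P vs) \<longleftrightarrow> (\<forall>v\<in>prop_set (T, U). \<forall>ws\<in>arg_set \<kappa>. P (v # ws))"
  by (auto simp: in_arg_set_RFun)

text \<open>Unrolls the recursion over all arguments at once, the form in which the interpretation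
  of refined types speaks about argument lists.\<close>

lemma affine_rel_iff:
  "affine_rel a \<kappa> d d1 d2 \<longleftrightarrow>
    (\<forall>us\<in>arg_set \<kappa>. \<forall>vs\<in>arg_set \<kappa>. affine_rel a (case_prod RProp (res_type \<kappa>))
       (apply_val d (map2 (mix a) us vs)) (apply_val d1 us) (apply_val d2 vs))"
proof (induction \<kappa> arbitrary: d d1 d2)
  case (RProp T U)
  then show ?case by (simp add: in_arg_set_RProp apply_val_def)
next
  case (RFun T U \<kappa>)
  have "affine_rel a (RFun T U \<kappa>) d d1 d2 \<longleftrightarrow>
    (\<forall>u\<in>prop_set (T, U). \<forall>v\<in>prop_set (T, U). \<forall>us\<in>arg_set \<kappa>. \<forall>vs\<in>arg_set \<kappa>.
      affine_rel a (case_prod RProp (res_type \<kappa>))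
        (apply_val d (map2 (mix a) (u # us) (v # vs)))
        (apply_val d1 (u # us)) (apply_val d2 (v # vs)))"
    unfolding affine_rel.simps RFun.IH by (simp add: apply_val_def)
  also have "\<dots> \<longleftrightarrow>
    (\<forall>us\<in>arg_set (RFun T U \<kappa>). \<forall>vs\<in>arg_set (RFun T U \<kappa>).
      affine_rel a (case_prod RProp (res_type (RFun T U \<kappa>)))
        (apply_val d (map2 (mix a) us vs)) (apply_val d1 us) (apply_val d2 vs))"
    by (simp only: ball_arg_set_RFun res_type.simps) blast
  finally show ?case .
qed

section \<open>From mixtures to coefficients and back\<close>

text \<open>Coordinates are released one at a time: those outside A are pinned to the base point
  \<open>v0\<close>. The slope in a released coordinate does not depend on the other coordinates, so
  it serves as the coefficient.\<close>

lemma affine_coefficients_coordinates: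
  fixes g :: "('s \<Rightarrow> real) \<Rightarrow> real"
  assumes mix: "\<And>a u v. 0 \<le> a \<Longrightarrow> a \<le> 1 \<Longrightarrow> u \<in> prop_set TU \<Longrightarrow> v \<in> prop_set TU \<Longrightarrow>
      g (mix a u v) = a * g u + (1 - a) * g v"
    and v0: "v0 \<in> prop_set TU" and "finite A"
  shows "\<exists>c0 c. \<forall>v\<in>prop_set TU. (\<forall>t. t \<notin> A \<longrightarrow> v t = v0 t) \<longrightarrow> g v = c0 + (\<Sum>t\<in>A. c t * v t)"
  using assms(3)
proof induction
  case empty
  have "g v = g v0 + (\<Sum>t\<in>{}. 0 * v t)" if "\<forall>t. t \<notin> {} \<longrightarrow> v t = v0 t" for v
  proof -
    have "v = v0" using that by (intro ext) simp
    then show ?thesis by simp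
  qed
  then show ?case by (intro exI[of _ "g v0"] exI[of _ "\<lambda>_. 0"]) blast
next
  case (insert j A)
  then obtain c0 c where IH: "\<And>v. v \<in> prop_set TU \<Longrightarrow> (\<And>t. t \<notin> A \<Longrightarrow> v t = v0 t) \<Longrightarrow>
    g v = c0 + (\<Sum>t\<in>A. c t * v t)" by blast
  define \<delta> where "\<delta> = g (v0(j := 1)) - g (v0(j := 0))"
  have sum_upd: "(\<Sum>t\<in>A. c t * (v(j := x)) t) = (\<Sum>t\<in>A. c t * v t)" for v x
    using insert.hyps by (intro sum.cong) auto
  have sum_ins: "(\<Sum>t\<in>insert j A. (c(j := y)) t * v t) = y * v j + (\<Sum>t\<in>A. c t * v t)" for v y
  proof -
    have "(\<Sum>t\<in>A. (c(j := y)) t * v t) = (\<Sum>t\<in>A. c t * v t)"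
      using insert.hyps by (intro sum.cong) auto
    then show ?thesis using insert.hyps by simp
  qed
  show ?case
  proof (cases "j \<in> fst TU \<union> snd TU")
    case True
    have "g v = c0 + (\<Sum>t\<in>insert j A. (c(j := 0)) t * v t)"
      if v: "v \<in> prop_set TU" and eq: "\<forall>t. t \<notin> insert j A \<longrightarrow> v t = v0 t" for v
    proof -
      \<comment> \<open>Coordinate j is forced to 0 or 1, so releasing it changes nothing and
        coefficient 0 will do.\<close>
      have "v t = v0 t" if "t \<notin> A" for t
        using that v eq True v0 by (cases "t = j") (auto simp: prop_set_def)
      then show ?thesis unfolding sum_ins using IH[OF v] by simp
    qed
    then show ?thesis by (intro exI[of _ c0] exI[of _ "c(j := 0)"]) blast
  next
    case False
    have upd: "v(j := x) \<in> prop_set TU" if "v \<in> prop_set TU" "0 \<le> x" "x \<le> 1" for v x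
      using that False by (auto simp: prop_set_def unit_val_def)
    have diff: "g (v(j := 1)) - g (v(j := 0)) = \<delta>" if v: "v \<in> prop_set TU" for v
    proof -
      \<comment> \<open>The diagonals of a parallelogram share their midpoint, so opposite sides in
        direction j have the same increment of g.\<close>
      have "mix (1/2) (v(j := 1)) (v0(j := 0)) = mix (1/2) (v(j := 0)) (v0(j := 1))"
        by (auto simp: mix_def fun_eq_iff)
      moreover have "g (mix (1/2) (v(j := 1)) (v0(j := 0))) = (g (v(j := 1)) + g (v0(j := 0))) / 2"
        using v v0 by (subst mix) (auto intro!: upd)
      moreover have "g (mix (1/2) (v(j := 0)) (v0(j := 1))) = (g (v(j := 0)) + g (v0(j := 1))) / 2"
        using v v0 by (subst mix) (auto intro!: upd)
      ultimately show ?thesis by (simp add: \<delta>_def)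
    qed
    \<comment> \<open>v itself is the mixture of its two faces in direction j, with weight
      \<open>v j\<close>.\<close>
    have split: "g v = v j * g (v(j := 1)) + (1 - v j) * g (v(j := 0))"
      if v: "v \<in> prop_set TU" for v
    proof -
      have "g (mix (v j) (v(j := 1)) (v(j := 0))) = v j * g (v(j := 1)) + (1 - v j) * g (v(j := 0))"
        using v by (intro mix upd) (auto simp: prop_set_def unit_val_def)
      moreover have "mix (v j) (v(j := 1)) (v(j := 0)) = v"
        by (auto simp: mix_def fun_eq_iff algebra_simps)
      ultimately show ?thesis by simp
    qed
    have slope: "g v = g (v(j := 0)) + v j * \<delta>" if "v \<in> prop_set TU" for v
      using split[OF that] by (simp add: algebra_simps flip: diff[OF that])
    \<comment> \<open>The induction hypothesis applies to v with coordinate j reset to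
      \<open>v0 j\<close>; moving back to \<open>v j\<close> adds (v j - v0 j) * \<delta>, whose
      second part goes into the constant.\<close>
    have "g v = (c0 - v0 j * \<delta>) + (\<Sum>t\<in>insert j A. (c(j := \<delta>)) t * v t)"
      if v: "v \<in> prop_set TU" and eq: "\<forall>t. t \<notin> insert j A \<longrightarrow> v t = v0 t" for v
    proof -
      have w: "v(j := v0 j) \<in> prop_set TU"
        using v v0 by (intro upd) (auto simp: prop_set_def unit_val_def)
      have "(v(j := v0 j)) t = v0 t" if "t \<notin> A" for t using that eq by auto
      then have "g (v(j := v0 j)) = c0 + (\<Sum>t\<in>A. c t * v t)"
        using IH[OF w] unfolding sum_upd by blast
      moreover have "g (v(j := v0 j)) = g (v(j := 0)) + v0 j * \<delta>" using slope[OF w] by simp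
      ultimately show ?thesis using slope[OF v] unfolding sum_ins by (simp add: algebra_simps)
    qed
    then show ?thesis by (intro exI[of _ "c0 - v0 j * \<delta>"] exI[of _ "c(j := \<delta>)"]) blast
  qed
qed

text \<open>With base arguments v0 and vs0, the map splits into a part depending on the first
  argument, a part depending on the others, and a constant; the former two have coefficients by the
  one-argument case and by induction.\<close>

lemma affine_coefficients:
  fixes g :: "('s::finite \<Rightarrow> real) list \<Rightarrow> real"
  assumes "\<And>a us vs. 0 \<le> a \<Longrightarrow> a \<le> 1 \<Longrightarrow> us \<in> arg_set \<kappa> \<Longrightarrow> vs \<in> arg_set \<kappa> \<Longrightarrow>
      g (map2 (mix a) us vs) = a * g us + (1 - a) * g vs"
  shows "\<exists>c0 c. \<forall>vs\<in>arg_set \<kappa>.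
    g vs = c0 + (\<Sum>i<length (arg_types \<kappa>). \<Sum>t\<in>UNIV. c i t * (vs ! i) t)"
  using assms
proof (induction \<kappa> arbitrary: g)
  case (RProp T U)
  then show ?case by (auto simp: in_arg_set_RProp)
next
  case (RFun T U \<kappa>)
  show ?case
  proof (cases "prop_set (T, U) = {} \<or> arg_set \<kappa> = {}")
    case True
    then have "arg_set (RFun T U \<kappa>) = {}" by (auto simp: in_arg_set_RFun)
    then show ?thesis by simp
  next
    case False
    then obtain v0 vs0 where v0: "v0 \<in> prop_set (T, U)" and vs0: "vs0 \<in> arg_set \<kappa>" by blast
    have mix: "g (mix a u v # map2 (mix a) us vs) = a * g (u # us) + (1 - a) * g (v # vs)"
      if "0 \<le> a" "a \<le> 1" "u \<in> prop_set (T, U)" "v \<in> prop_set (T, U)" "us \<in> arg_set \<kappa>"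
        "vs \<in> arg_set \<kappa>" for a u v us vs
      using RFun.prems[of a "u # us" "v # vs"] that by (simp add: in_arg_set_RFun)
    have "\<exists>c0 c. \<forall>v\<in>prop_set (T, U). (\<forall>t. t \<notin> UNIV \<longrightarrow> v t = v0 t) \<longrightarrow>
      g (v # vs0) = c0 + (\<Sum>t\<in>UNIV. c t * v t)"
      using mix[OF _ _ _ _ vs0 vs0] v0
      by (intro affine_coefficients_coordinates) (auto simp: map2_mix_self)
    then obtain b0 b where b: "\<And>v. v \<in> prop_set (T, U) \<Longrightarrow>
      g (v # vs0) = b0 + (\<Sum>t\<in>UNIV. b t * v t)" by auto
    have "\<exists>c0 c. \<forall>vs\<in>arg_set \<kappa>.
      g (v0 # vs) = c0 + (\<Sum>i<length (arg_types \<kappa>). \<Sum>t\<in>UNIV. c i t * (vs ! i) t)"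
      using mix[OF _ _ v0 v0] by (intro RFun.IH) auto
    then obtain c0 c where c: "\<And>vs. vs \<in> arg_set \<kappa> \<Longrightarrow>
      g (v0 # vs) = c0 + (\<Sum>i<length (arg_types \<kappa>). \<Sum>t\<in>UNIV. c i t * (vs ! i) t)" by blast
    define c' where "c' i = (case i of 0 \<Rightarrow> b | Suc k \<Rightarrow> c k)" for i
    have "g (v # vs) = (b0 + c0 - g (v0 # vs0)) +
        (\<Sum>i<length (arg_types (RFun T U \<kappa>)). \<Sum>t\<in>UNIV. c' i t * ((v # vs) ! i) t)"
      if v: "v \<in> prop_set (T, U)" and vs: "vs \<in> arg_set \<kappa>" for v vs
    proof -
      have len: "length vs = length vs0"
        using vs vs0 by (auto simp: arg_set_def dest!: list_all2_lengthD)
      \<comment> \<open>Again two pairs share a midpoint: (v, vs) with (v0, vs0), and (v, vs0) with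
        (v0, vs).\<close>
      have "mix (1/2) v v0 = mix (1/2) v0 v"
        by (auto simp: mix_def fun_eq_iff)
      moreover have "map2 (mix (1/2)) vs vs0 = map2 (mix (1/2)) vs0 vs"
        using len by (induction vs vs0 rule: list_induct2) (auto simp: mix_def fun_eq_iff)
      ultimately have "g (v # vs) + g (v0 # vs0) = g (v # vs0) + g (v0 # vs)"
        using mix[of "1/2" v v0 vs vs0] mix[of "1/2" v v0 vs0 vs] v v0 vs vs0 by simp
      then show ?thesis
        using b[OF v] c[OF vs] by (simp add: c'_def sum.lessThan_Suc_shift del: sum.lessThan_Suc)
    qed
    then show ?thesis
      by (intro exI[of _ "b0 + c0 - g (v0 # vs0)"] exI[of _ c']) (auto simp: in_arg_set_RFun)
  qed
qed

text \<open>The linear part respects mixtures termwise, and the constant does because the weights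
  sum to 1. The mixed arguments must lie in the box, since the coefficients are valid only
  there.\<close>

lemma affine_on_mix:
  assumes "affine_on (arg_set \<kappa>) (length (arg_types \<kappa>)) d"
    and us: "us \<in> arg_set \<kappa>" and vs: "vs \<in> arg_set \<kappa>" and "map2 (mix a) us vs \<in> arg_set \<kappa>"
  shows "the_prop (apply_val d (map2 (mix a) us vs)) =
    mix a (the_prop (apply_val d us)) (the_prop (apply_val d vs))"
proof
  fix s
  let ?k = "length (arg_types \<kappa>)"
  obtain c0 c where c: "\<And>vs. vs \<in> arg_set \<kappa> \<Longrightarrow>
      the_prop (apply_val d vs) s = c0 + (\<Sum>i<?k. \<Sum>t\<in>UNIV. c i t * (vs ! i) t)"
    using assms(1) unfolding affine_on_def by metis
  have len: "length us = ?k" "length vs = ?k"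
    using us vs by (auto simp: arg_set_def dest: list_all2_lengthD)
  have "(\<Sum>i<?k. \<Sum>t\<in>UNIV. c i t * (map2 (mix a) us vs ! i) t) =
    (\<Sum>i<?k. \<Sum>t\<in>UNIV. a * (c i t * (us ! i) t) + (1 - a) * (c i t * (vs ! i) t))"
    using len by (intro sum.cong) (auto simp: mix_def algebra_simps)
  also have "\<dots> = a * (\<Sum>i<?k. \<Sum>t\<in>UNIV. c i t * (us ! i) t) +
      (1 - a) * (\<Sum>i<?k. \<Sum>t\<in>UNIV. c i t * (vs ! i) t)"
    by (simp add: sum.distrib sum_distrib_left)
  finally show "the_prop (apply_val d (map2 (mix a) us vs)) s =
      mix a (the_prop (apply_val d us)) (the_prop (apply_val d vs)) s"
    using c us vs assms(4) by (simp add: mix_def algebra_simps)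
qed

lemma mix_in_arg_set:
  "0 \<le> a \<Longrightarrow> a \<le> 1 \<Longrightarrow> us \<in> arg_set \<kappa> \<Longrightarrow> vs \<in> arg_set \<kappa> \<Longrightarrow> map2 (mix a) us vs \<in> arg_set \<kappa>"
  by (induction \<kappa> arbitrary: us vs)
    (auto simp: in_arg_set_RProp in_arg_set_RFun intro: mix_in_prop_set)

text \<open>The bridge between coefficients and mixtures: a value has the refined type iff it is
  related to itself at every weight.\<close>

lemma dom_rty_iff:
  "d \<in> dom_rty \<kappa> \<longleftrightarrow>
    d \<in> dom_ty (tr \<kappa>) \<and> (\<forall>a. 0 \<le> a \<longrightarrow> a \<le> 1 \<longrightarrow> affine_rel a \<kappa> d d d)"
proof (cases \<kappa>)
  case (RProp T U)
  have "d \<in> VProp ` prop_set (T, U)" if "\<forall>a. 0 \<le> a \<longrightarrow> a \<le> 1 \<longrightarrow> affine_rel a (RProp T U) d d d"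
    using that[rule_format, of 0] by simp
  then show ?thesis using RProp by (auto simp: dom_rty_def prop_set_def)
next
  case (RFun T U \<kappa>')
  let ?P = "\<forall>us\<in>arg_set \<kappa>. apply_val d us \<in> VProp ` prop_set (res_type \<kappa>)"
  let ?A = "affine_on (arg_set \<kappa>) (length (arg_types \<kappa>)) d"
  obtain T' U' where res: "res_type \<kappa> = (T', U')" by fastforce
  have "(\<forall>a. 0 \<le> a \<longrightarrow> a \<le> 1 \<longrightarrow> affine_rel a \<kappa> d d d) \<longleftrightarrow> ?A \<and> ?P"
  proof (intro iffI conjI allI impI)
    assume *: "\<forall>a. 0 \<le> a \<longrightarrow> a \<le> 1 \<longrightarrow> affine_rel a \<kappa> d d d"
    then have **: "affine_rel a (RProp T' U') (apply_val d (map2 (mix a) us vs))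
        (apply_val d us) (apply_val d vs)"
      if "0 \<le> a" "a \<le> 1" "us \<in> arg_set \<kappa>" "vs \<in> arg_set \<kappa>" for a us vs
      using that res affine_rel_iff[of a \<kappa> d d d] by simp
    \<comment> \<open>Any weight would do: at type Prop the relation contains the bounds of the
      result type.\<close>
    show ?P using **[of 0] res by auto
    show ?A unfolding affine_on_def
    proof
      fix s
      show "\<exists>c0 c. \<forall>vs\<in>arg_set \<kappa>. the_prop (apply_val d vs) s =
          c0 + (\<Sum>i<length (arg_types \<kappa>). \<Sum>t\<in>UNIV. c i t * (vs ! i) t)"
      proof (rule affine_coefficients)
        fix a :: real and us vs
        assume "0 \<le> a" "a \<le> 1" "us \<in> arg_set \<kappa>" "vs \<in> arg_set \<kappa>"
        from **[OF this] show "the_prop (apply_val d (map2 (mix a) us vs)) s =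
            a * the_prop (apply_val d us) s + (1 - a) * the_prop (apply_val d vs) s"
          by (simp add: mix_def)
      qed
    qed
  next
    fix a :: real assume AP: "?A \<and> ?P" and a: "0 \<le> a" "a \<le> 1"
    have "affine_rel a (RProp T' U') (apply_val d (map2 (mix a) us vs))
        (apply_val d us) (apply_val d vs)" if "us \<in> arg_set \<kappa>" "vs \<in> arg_set \<kappa>" for us vs
    proof -
      note m = mix_in_arg_set[OF a that]
      \<comment> \<open>Affinity only constrains \<open>the_prop\<close>; the constructor comes from
        the condition on results.\<close>
      have "\<exists>w. apply_val d (map2 (mix a) us vs) = VProp w" using AP m by blast
      then show ?thesis
        using AP affine_on_mix[of \<kappa> d us vs a] m that res by (auto simp: image_iff)
    qed
    then show "affine_rel a \<kappa> d d d" using res by (subst affine_rel_iff) simp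
  qed
  then show ?thesis using RFun by (auto simp: dom_rty_def)
qed

section \<open>Closure of refined types under limits\<close>

text \<open>Being 0 or 1 at a state and being a given mixture are closed conditions on real numbers.
  Three families are needed because the function case applies them to three different
  arguments.\<close>

lemma affine_rel_limit:
  assumes "G \<noteq> bot" and a: "0 \<le> a" "a \<le> 1"
  shows "conv_val (tr \<kappa>) G p d \<Longrightarrow> conv_val (tr \<kappa>) G q d1 \<Longrightarrow> conv_val (tr \<kappa>) G r d2 \<Longrightarrow>
    d \<in> dom_ty (tr \<kappa>) \<Longrightarrow> d1 \<in> dom_ty (tr \<kappa>) \<Longrightarrow> d2 \<in> dom_ty (tr \<kappa>) \<Longrightarrow>
    \<forall>\<^sub>F i in G. affine_rel a \<kappa> (p i) (q i) (r i) \<Longrightarrow> affine_rel a \<kappa> d d1 d2"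
proof (induction \<kappa> arbitrary: p q r d d1 d2)
  case (RProp T U)
  obtain w u v where wuv: "d = VProp w" "d1 = VProp u" "d2 = VProp v" "u \<in> unit_val" "v \<in> unit_val"
    using RProp.prems(4-6) by auto
  have lim: "((\<lambda>i. the_prop (p i) s) \<longlongrightarrow> w s) G" "((\<lambda>i. the_prop (q i) s) \<longlongrightarrow> u s) G"
    "((\<lambda>i. the_prop (r i) s) \<longlongrightarrow> v s) G" for s
    using RProp.prems(1-3) wuv by auto
  have lim_const: "l = c" if "(f \<longlongrightarrow> l) G" "\<forall>\<^sub>F i in G. f i = c" for f and l c :: real
    using tendsto_unique[OF assms(1) that(1)] tendsto_eventually[OF that(2)] by blast
  have bounds: "l \<in> prop_set (T, U)"
    if "l \<in> unit_val" "\<And>s. ((\<lambda>i. the_prop (f i) s) \<longlongrightarrow> l s) G"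
      "\<forall>\<^sub>F i in G. f i \<in> VProp ` prop_set (T, U)" for l f
  proof -
    have "\<forall>\<^sub>F i in G. the_prop (f i) s = 0" if "s \<in> T" for s
      using \<open>\<forall>\<^sub>F i in G. f i \<in> VProp ` prop_set (T, U)\<close>
      by (rule eventually_mono) (use that in \<open>auto simp: prop_set_def\<close>)
    moreover have "\<forall>\<^sub>F i in G. the_prop (f i) s = 1" if "s \<in> U" for s
      using \<open>\<forall>\<^sub>F i in G. f i \<in> VProp ` prop_set (T, U)\<close>
      by (rule eventually_mono) (use that in \<open>auto simp: prop_set_def\<close>)
    ultimately show ?thesis
      using that(1) lim_const[OF that(2)] by (simp add: prop_set_def)
  qed
  have "u \<in> prop_set (T, U)"
    by (rule bounds[OF wuv(4) lim(2)]) (use RProp.prems(7) in \<open>auto elim: eventually_mono\<close>)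
  moreover have "v \<in> prop_set (T, U)"
    by (rule bounds[OF wuv(5) lim(3)]) (use RProp.prems(7) in \<open>auto elim: eventually_mono\<close>)
  moreover have "w s = mix a u v s" for s
  proof (rule tendsto_unique[OF assms(1) lim(1)])
    have "((\<lambda>i. a * the_prop (q i) s + (1 - a) * the_prop (r i) s) \<longlongrightarrow> mix a u v s) G"
      unfolding mix_def by (intro tendsto_intros lim)
    then show "((\<lambda>i. the_prop (p i) s) \<longlongrightarrow> mix a u v s) G"
      by (rule Lim_transform_eventually)
        (use RProp.prems(7) in \<open>auto simp: mix_def elim: eventually_mono\<close>)
  qed
  ultimately show ?case using wuv by (auto simp: fun_eq_iff)
next
  case (RFun T U \<kappa>)
  show ?case unfolding affine_rel.simps
  proof (intro ballI)
    fix u v assume u: "u \<in> prop_set (T, U)" and v: "v \<in> prop_set (T, U)"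
    note un = prop_set_unit_val[OF u] prop_set_unit_val[OF v]
      prop_set_unit_val[OF mix_in_prop_set[OF a u v]]
    show "affine_rel a \<kappa> (the_fun d (mix a u v)) (the_fun d1 u) (the_fun d2 v)"
    proof (rule RFun.IH)
      show "\<forall>\<^sub>F i in G. affine_rel a \<kappa> (the_fun (p i) (mix a u v)) (the_fun (q i) u) (the_fun (r i) v)"
        using RFun.prems(7) by (rule eventually_mono) (use u v in simp)
    qed (use RFun.prems(1-6) un the_fun_in_dom_ty in auto)
  qed
qed

lemma limit_closed_dom_rty: "limit_closed (tr \<kappa>) (dom_rty \<kappa>)"
  unfolding limit_closed_def
proof (intro allI impI)
  fix G and l :: "'a val"
  assume *: "G \<noteq> bot" "\<forall>\<^sub>F d in G. d \<in> dom_rty \<kappa>" "conv_val (tr \<kappa>) G (\<lambda>d. d) l" "l \<in> dom_ty (tr \<kappa>)"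
  have "affine_rel a \<kappa> l l l" if "0 \<le> a" "a \<le> 1" for a
  proof (rule affine_rel_limit[OF *(1) that *(3,3,3,4,4,4)])
    show "\<forall>\<^sub>F d in G. affine_rel a \<kappa> d d d"
      using *(2) by (rule eventually_mono) (use that in \<open>auto simp: dom_rty_iff\<close>)
  qed
  then show "l \<in> dom_rty \<kappa>" using *(4) by (simp add: dom_rty_iff)
qed

lemma dom_rty_subset: "dom_rty \<kappa> \<subseteq> dom_ty (tr \<kappa>)"
  by (auto simp: dom_rty_iff)

text \<open>Here the restriction on result types in the fixpoint rules enters: 0 is compatible with
  T alone and 1 with U alone. A constant map trivially respects mixtures.\<close>

lemma const_val_in_dom_rty:
  assumes "c = 0 \<and> snd (res_type \<kappa>) = {} \<or> c = 1 \<and> fst (res_type \<kappa>) = {}"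
  shows "const_val c (tr \<kappa>) \<in> dom_rty \<kappa>"
proof -
  have "affine_rel a \<kappa> (const_val c (tr \<kappa>)) (const_val c (tr \<kappa>)) (const_val c (tr \<kappa>))"
    if a: "0 \<le> a" "a \<le> 1" for a
    using assms
  proof (induction \<kappa>)
    case (RProp T U)
    then show ?case by (auto simp: prop_set_def unit_val_def)
  next
    case (RFun T U \<kappa>)
    then show ?case
      by (auto dest: prop_set_unit_val mix_in_prop_set[OF a])
  qed
  then show ?thesis using assms by (auto simp: dom_rty_iff intro!: const_val_in_dom_ty)
qed


section \<open>Soundness of refined typing\<close>

text \<open>Bindings of \<Delta> take precedence, so that appending one is a map update, as simple
  typing of abstractions demands.\<close>

definition ctx_ty :: "('x \<rightharpoonup> 's rty) \<Rightarrow> ('x, 's) binding list \<Rightarrow> 'x \<rightharpoonup> ty" where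
  "ctx_ty \<Sigma> \<Delta> X = (if X \<in> fst ` set \<Delta> then Some Prop else tr_env \<Sigma> X)"

lemma ctx_ty_Nil [simp]: "ctx_ty \<Sigma> [] = tr_env \<Sigma>"
  by (simp add: ctx_ty_def fun_eq_iff)

lemma ctx_ty_snoc: "ctx_ty \<Sigma> (\<Delta> @ [(X, T, U)]) = (ctx_ty \<Sigma> \<Delta>)(X \<mapsto> Prop)"
  by (auto simp: ctx_ty_def fun_eq_iff)

lemma tr_env_upd: "tr_env (\<Sigma>(X \<mapsto> \<kappa>)) = (tr_env \<Sigma>)(X \<mapsto> tr \<kappa>)"
  by (auto simp: tr_env_def fun_eq_iff)

lemma has_type_simply_typed: "has_type M \<Sigma> \<Delta> \<phi> \<kappa> \<Longrightarrow> simply_typed (ctx_ty \<Sigma> \<Delta>) \<phi> (tr \<kappa>)"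
proof (induction rule: has_type.induct)
  case (Weak \<Sigma> \<Delta> \<phi> \<kappa> X T U)
  then have "ctx_ty \<Sigma> \<Delta> \<subseteq>\<^sub>m ctx_ty \<Sigma> ((X, T, U) # \<Delta>)"
    by (auto simp: map_le_def ctx_ty_def tr_env_def dom_def)
  then show ?case using Weak simply_typed_weaken by blast
next
  case (Ex \<Sigma> \<Delta>1 b1 b2 \<Delta>2 \<phi> \<kappa>)
  have "ctx_ty \<Sigma> (\<Delta>1 @ b1 # b2 # \<Delta>2) = ctx_ty \<Sigma> (\<Delta>1 @ b2 # b1 # \<Delta>2)"
    by (simp add: ctx_ty_def fun_eq_iff)
  then show ?case using Ex by simp
next
  case (Var \<Sigma> X T U)
  then show ?case by (auto intro!: simply_typed.intros simp: ctx_ty_def)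
next
  case (FVar \<Sigma> X \<kappa>)
  then show ?case by (auto intro!: simply_typed.intros simp: tr_env_def)
next
  case (Mu \<Sigma> X \<kappa> \<phi>)
  then show ?case unfolding ctx_ty_Nil tr_env_upd by (intro simply_typed.intros)
next
  case (Nu \<Sigma> X \<kappa> \<phi>)
  then show ?case unfolding ctx_ty_Nil tr_env_upd by (intro simply_typed.intros)
next
  case (Abs \<Sigma> \<Delta> X T U \<phi> \<kappa>)
  then show ?case unfolding ctx_ty_snoc tr.simps by (intro simply_typed.intros)
qed (auto intro: simply_typed.intros)

lemma has_type_distinct:
  "has_type M \<Sigma> \<Delta> \<phi> \<kappa> \<Longrightarrow> distinct (map fst \<Delta>) \<and> fst ` set \<Delta> \<inter> dom \<Sigma> = {}"
  by (induction rule: has_type.induct) auto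

lemma dom_env_cong: "\<eta> \<in> dom_env \<Sigma> \<Longrightarrow> (\<And>X. X \<in> dom \<Sigma> \<Longrightarrow> \<eta>' X = \<eta> X) \<Longrightarrow> \<eta>' \<in> dom_env \<Sigma>"
  by (auto simp: dom_env_def dom_def)

lemma dom_env_upd: "\<eta> \<in> dom_env \<Sigma> \<Longrightarrow> d \<in> dom_rty \<kappa> \<Longrightarrow> \<eta>(X := d) \<in> dom_env (\<Sigma>(X \<mapsto> \<kappa>))"
  by (auto simp: dom_env_def dom_rty_iff)

lemma dom_env_env_le: "\<eta> \<in> dom_env \<Sigma> \<Longrightarrow> env_le (tr_env \<Sigma>) \<eta> \<eta>"
  by (auto simp: dom_env_def env_le_def tr_env_def dom_le_refl)

lemma sem_in_dom_ty:
  assumes "markov_chain M" "has_type M \<Sigma> [] \<phi> \<kappa>" "\<eta> \<in> dom_env \<Sigma>"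
  shows "sem M \<phi> (tr \<kappa>) \<eta> \<in> dom_ty (tr \<kappa>)"
  using simply_typed_sound[OF assms(1) _ dom_env_env_le[OF assms(3)]] has_type_simply_typed[OF assms(2)]
  by (simp add: dom_le_refl)

text \<open>Variables outside \<Delta>, in particular those of \<Sigma>, are not mixed; thus an
  empty \<Delta> forces the three environments to coincide.\<close>

definition env_rel ::
  "real \<Rightarrow> ('x, 's) binding list \<Rightarrow> ('x \<Rightarrow> 's val) \<Rightarrow> ('x \<Rightarrow> 's val) \<Rightarrow> ('x \<Rightarrow> 's val) \<Rightarrow> bool"
where
  "env_rel a \<Delta> \<eta> \<eta>1 \<eta>2 \<longleftrightarrow>
     (\<forall>X. X \<notin> fst ` set \<Delta> \<longrightarrow> \<eta>1 X = \<eta> X \<and> \<eta>2 X = \<eta> X) \<and>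
     (\<forall>(X, T, U)\<in>set \<Delta>. affine_rel a (RProp T U) (\<eta> X) (\<eta>1 X) (\<eta>2 X))"

lemma env_rel_Nil: "env_rel a [] \<eta> \<eta>1 \<eta>2 \<longleftrightarrow> \<eta>1 = \<eta> \<and> \<eta>2 = \<eta>"
  by (auto simp: env_rel_def)

lemma env_relI:
  assumes "\<And>X. X \<notin> fst ` set \<Delta> \<Longrightarrow> \<eta>1 X = \<eta> X" "\<And>X. X \<notin> fst ` set \<Delta> \<Longrightarrow> \<eta>2 X = \<eta> X"
    and "\<And>X T U. (X, T, U) \<in> set \<Delta> \<Longrightarrow> affine_rel a (RProp T U) (\<eta> X) (\<eta>1 X) (\<eta>2 X)"
  shows "env_rel a \<Delta> \<eta> \<eta>1 \<eta>2"
  using assms unfolding env_rel_def by blast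

lemma env_rel_unbound:
  "env_rel a \<Delta> \<eta> \<eta>1 \<eta>2 \<Longrightarrow> X \<notin> fst ` set \<Delta> \<Longrightarrow> \<eta>1 X = \<eta> X \<and> \<eta>2 X = \<eta> X"
  unfolding env_rel_def by blast

lemma env_rel_bound:
  "env_rel a \<Delta> \<eta> \<eta>1 \<eta>2 \<Longrightarrow> (X, T, U) \<in> set \<Delta> \<Longrightarrow>
    affine_rel a (RProp T U) (\<eta> X) (\<eta>1 X) (\<eta>2 X)"
  unfolding env_rel_def by blast

text \<open>Two levels meet here: monotonicity on all of \<open>dom_ty\<close> comes from simple
  typing, invariance of \<open>dom_rty \<kappa>\<close> is the hypothesis on the body.\<close>

lemma sem_fix_in_dom_rty:
  assumes M: "markov_chain M" and ty: "has_type M (\<Sigma>(X \<mapsto> \<kappa>)) [] \<phi> \<kappa>" and \<eta>: "\<eta> \<in> dom_env \<Sigma>"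
    and IH: "\<And>d. d \<in> dom_rty \<kappa> \<Longrightarrow> sem M \<phi> (tr \<kappa>) (\<eta>(X := d)) \<in> dom_rty \<kappa>"
  shows "snd (res_type \<kappa>) = {} \<Longrightarrow> sem M (Mu X \<phi>) (tr \<kappa>) \<eta> \<in> dom_rty \<kappa>"
    and "fst (res_type \<kappa>) = {} \<Longrightarrow> sem M (Nu X \<phi>) (tr \<kappa>) \<eta> \<in> dom_rty \<kappa>"
proof -
  have st: "simply_typed ((tr_env \<Sigma>)(X \<mapsto> tr \<kappa>)) \<phi> (tr \<kappa>)"
    using has_type_simply_typed[OF ty] by (simp add: tr_env_upd)
  have F: "dom_le (tr \<kappa>) (sem M \<phi> (tr \<kappa>) (\<eta>(X := d))) (sem M \<phi> (tr \<kappa>) (\<eta>(X := e)))"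
    if "dom_le (tr \<kappa>) d e" for d e
    using simply_typed_sound[OF M st] env_le_upd[OF dom_env_env_le[OF \<eta>] that] by blast
  have dom: "sem M \<phi> (tr \<kappa>) (\<eta>(X := d)) \<in> dom_ty (tr \<kappa>)" if "d \<in> dom_ty (tr \<kappa>)" for d
    using F[of d d] that by (simp add: dom_le_refl)
  have mono: "le_val (tr \<kappa>) (sem M \<phi> (tr \<kappa>) (\<eta>(X := d))) (sem M \<phi> (tr \<kappa>) (\<eta>(X := e)))"
    if "d \<in> dom_ty (tr \<kappa>)" "e \<in> dom_ty (tr \<kappa>)" "le_val (tr \<kappa>) d e" for d e
    using F[of d e] that by (simp add: dom_le_def)
  show "sem M (Mu X \<phi>) (tr \<kappa>) \<eta> \<in> dom_rty \<kappa>" if "snd (res_type \<kappa>) = {}"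
    unfolding sem.simps using that
    by (intro least_fix_spec[THEN conjunct1] dom_rty_subset limit_closed_dom_rty const_val_in_dom_rty
        dom IH mono) auto
  show "sem M (Nu X \<phi>) (tr \<kappa>) \<eta> \<in> dom_rty \<kappa>" if "fst (res_type \<kappa>) = {}"
    unfolding sem.simps using that
    by (intro greatest_fix_spec[THEN conjunct1] dom_rty_subset limit_closed_dom_rty const_val_in_dom_rty
        dom IH mono) auto
qed

section \<open>Effect of the operators on bounds and mixtures\<close>

lemma min_max_prop_set:
  assumes "u \<in> prop_set (T1, U1)" "v \<in> prop_set (T2, U2)"
  shows "(\<lambda>s. min (u s) (v s)) \<in> prop_set (T1 \<union> T2, U1 \<inter> U2)"
    and "(\<lambda>s. max (u s) (v s)) \<in> prop_set (T1 \<inter> T2, U1 \<union> U2)"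
  using assms by (auto simp: prop_set_def unit_val_def min_def max_def) (metis order_antisym)+

text \<open>
  The side condition of the rules for conjunction and disjunction makes one of the two operands
  constantly \<open>0\<close> or \<open>1\<close> at each state, so that minimum and maximum are affine there.
\<close>

lemma min_max_mix:
  assumes "T1 \<union> U1 \<union> T2 \<union> U2 = UNIV" and a: "0 \<le> a" "a \<le> 1"
    and u: "u \<in> prop_set (T1, U1)" "u' \<in> prop_set (T1, U1)"
    and v: "v \<in> prop_set (T2, U2)" "v' \<in> prop_set (T2, U2)"
  shows "(\<lambda>s. min (mix a u u' s) (mix a v v' s)) = mix a (\<lambda>s. min (u s) (v s)) (\<lambda>s. min (u' s) (v' s))"
    and "(\<lambda>s. max (mix a u u' s) (mix a v v' s)) = mix a (\<lambda>s. max (u s) (v s)) (\<lambda>s. max (u' s) (v' s))"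
proof -
  note mu = mix_in_prop_set[OF a u] and mv = mix_in_prop_set[OF a v]
  have b: "0 \<le> w s" "w s \<le> 1" if "w \<in> prop_set TU" for w :: "'a \<Rightarrow> real" and TU s
    using that by (auto simp: prop_set_def unit_val_def)
  have c: "w s = 0" if "w \<in> prop_set (T, U)" "s \<in> T" for w :: "'a \<Rightarrow> real" and T U s
    using that by (auto simp: prop_set_def)
  have d: "w s = 1" if "w \<in> prop_set (T, U)" "s \<in> U" for w :: "'a \<Rightarrow> real" and T U s
    using that by (auto simp: prop_set_def)
  have "min (mix a u u' s) (mix a v v' s) = mix a (\<lambda>s. min (u s) (v s)) (\<lambda>s. min (u' s) (v' s)) s \<and>
    max (mix a u u' s) (mix a v v' s) = mix a (\<lambda>s. max (u s) (v s)) (\<lambda>s. max (u' s) (v' s)) s" for s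
  proof -
    note bs = b[OF u(1), of s] b[OF u(2), of s] b[OF v(1), of s] b[OF v(2), of s]
      b[OF mu, of s] b[OF mv, of s]
    consider "s \<in> T1" | "s \<in> U1" | "s \<in> T2" | "s \<in> U2" using assms(1) by blast
    then show ?thesis
    proof cases
      case 1
      then show ?thesis
        using c[OF u(1)] c[OF u(2)] c[OF mu] bs by (simp add: mix_def min_absorb1 max_absorb2)
    next
      case 2
      then show ?thesis
        using d[OF u(1)] d[OF u(2)] d[OF mu] bs by (simp add: mix_def min_absorb2 max_absorb1)
    next
      case 3
      then show ?thesis
        using c[OF v(1)] c[OF v(2)] c[OF mv] bs by (simp add: mix_def min_absorb2 max_absorb1)
    next
      case 4
      then show ?thesis
        using d[OF v(1)] d[OF v(2)] d[OF mv] bs by (simp add: mix_def min_absorb1 max_absorb2)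
    qed
  qed
  then show "(\<lambda>s. min (mix a u u' s) (mix a v v' s)) = mix a (\<lambda>s. min (u s) (v s)) (\<lambda>s. min (u' s) (v' s))"
    and "(\<lambda>s. max (mix a u u' s) (mix a v v' s)) = mix a (\<lambda>s. max (u s) (v s)) (\<lambda>s. max (u' s) (v' s))"
    by (auto simp: fun_eq_iff)
qed

text \<open>The excluded thresholds are those that 0 would meet or 1 would miss.\<close>

lemma threshold_prop_set:
  assumes "valid_threshold J" "v \<in> prop_set (T, U)"
  shows "(\<lambda>s. if in_threshold (v s) J then 1 else 0) \<in> prop_set (T, U)"
proof -
  have "\<not> in_threshold 0 J" "in_threshold 1 J" using assms(1) by (cases J; simp)+
  then show ?thesis using assms(2) by (auto simp: prop_set_def unit_val_def)
qed

text \<open>Every state has a successor, so the minimum is attained and inherits the bounds of the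
  attaining value.\<close>

lemma Min_succs_prop_set:
  assumes "markov_chain M" "v \<in> prop_set (T, U)"
  shows "(\<lambda>s. Min (v ` succs M s)) \<in>
    prop_set ({s. \<exists>t\<in>T. trans M s t > 0}, {s. \<forall>t. trans M s t > 0 \<longrightarrow> t \<in> U})"
proof -
  have fin: "finite (v ` succs M s)" and ne: "v ` succs M s \<noteq> {}" for s
    using succs_nonempty[OF assms(1)] by auto
  have v: "0 \<le> v s" "v s \<le> 1" for s using assms(2) by (auto simp: prop_set_def unit_val_def)
  have in_v: "Min (v ` succs M s) \<in> v ` succs M s" for s using fin ne by (rule Min_in)
  have "Min (v ` succs M s) = 0" if "t \<in> T" "trans M s t > 0" for s t
  proof (rule Min_eqI[OF fin])
    show "0 \<in> v ` succs M s" using that assms(2) by (force simp: prop_set_def succs_def)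
  qed (use v in auto)
  moreover have "Min (v ` succs M s) = 1" if "\<forall>t. trans M s t > 0 \<longrightarrow> t \<in> U" for s
    using in_v[of s] that assms(2) by (auto simp: prop_set_def succs_def)
  moreover have "0 \<le> Min (v ` succs M s) \<and> Min (v ` succs M s) \<le> 1" for s
    using in_v[of s] v by (metis imageE)
  ultimately show ?thesis by (auto simp: prop_set_def unit_val_def)
qed

lemma Max_succs_prop_set:
  assumes "markov_chain M" "v \<in> prop_set (T, U)"
  shows "(\<lambda>s. Max (v ` succs M s)) \<in>
    prop_set ({s. \<forall>t. trans M s t > 0 \<longrightarrow> t \<in> T}, {s. \<exists>t\<in>U. trans M s t > 0})"
proof -
  have fin: "finite (v ` succs M s)" and ne: "v ` succs M s \<noteq> {}" for s
    using succs_nonempty[OF assms(1)] by auto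
  have v: "0 \<le> v s" "v s \<le> 1" for s using assms(2) by (auto simp: prop_set_def unit_val_def)
  have in_v: "Max (v ` succs M s) \<in> v ` succs M s" for s using fin ne by (rule Max_in)
  have "Max (v ` succs M s) = 1" if "t \<in> U" "trans M s t > 0" for s t
  proof (rule Max_eqI[OF fin])
    show "1 \<in> v ` succs M s" using that assms(2) by (force simp: prop_set_def succs_def)
  qed (use v in auto)
  moreover have "Max (v ` succs M s) = 0" if "\<forall>t. trans M s t > 0 \<longrightarrow> t \<in> T" for s
    using in_v[of s] that assms(2) by (auto simp: prop_set_def succs_def)
  moreover have "0 \<le> Max (v ` succs M s) \<and> Max (v ` succs M s) \<le> 1" for s
    using in_v[of s] v by (metis imageE)
  ultimately show ?thesis by (auto simp: prop_set_def unit_val_def)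
qed

lemma expectation_prop_set:
  assumes "markov_chain M" "v \<in> prop_set (T, U)"
  shows "(\<lambda>s. \<Sum>t\<in>UNIV. trans M s t * v t) \<in>
    prop_set ({s. \<forall>t. trans M s t > 0 \<longrightarrow> t \<in> T}, {s. \<forall>t. trans M s t > 0 \<longrightarrow> t \<in> U})"
proof -
  have v: "0 \<le> v s" "v s \<le> 1" for s using assms(2) by (auto simp: prop_set_def unit_val_def)
  have "(\<Sum>t\<in>UNIV. trans M s t * v t) = 0" if "\<forall>t. trans M s t > 0 \<longrightarrow> t \<in> T" for s
    using that assms(2) by (intro expectation_const[OF assms(1)]) (auto simp: prop_set_def)
  moreover have "(\<Sum>t\<in>UNIV. trans M s t * v t) = 1" if "\<forall>t. trans M s t > 0 \<longrightarrow> t \<in> U" for s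
    using that assms(2) by (intro expectation_const[OF assms(1)]) (auto simp: prop_set_def)
  moreover have "0 \<le> (\<Sum>t\<in>UNIV. trans M s t * v t)" for s
    using expectation_le[OF assms(1), of "\<lambda>_. 0" v s] v by simp
  moreover have "(\<Sum>t\<in>UNIV. trans M s t * v t) \<le> 1" for s
    using expectation_le[OF assms(1), of v "\<lambda>_. 1" s] expectation_const[OF assms(1), of s "\<lambda>_. 1" 1]
      v by simp
  ultimately show ?thesis by (auto simp: prop_set_def unit_val_def)
qed

lemma prop_set_mono: "v \<in> prop_set (T, U) \<Longrightarrow> T' \<subseteq> T \<Longrightarrow> U' \<subseteq> U \<Longrightarrow> v \<in> prop_set (T', U')"
  by (auto simp: prop_set_def)

section \<open>The induction on derivations\<close>

text \<open>The fundamental lemma of the ternary relation. A general \<Delta> is carried along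
  because the body of an abstraction is evaluated at three different arguments.\<close>

lemma has_type_sound:
  assumes M: "markov_chain M"
  shows "has_type M \<Sigma> \<Delta> \<phi> \<kappa> \<Longrightarrow> phfl_formula \<phi> \<Longrightarrow> \<eta> \<in> dom_env \<Sigma> \<Longrightarrow> 0 \<le> a \<Longrightarrow> a \<le> 1 \<Longrightarrow>
    env_rel a \<Delta> \<eta> \<eta>1 \<eta>2 \<Longrightarrow>
    affine_rel a \<kappa> (sem M \<phi> (tr \<kappa>) \<eta>) (sem M \<phi> (tr \<kappa>) \<eta>1) (sem M \<phi> (tr \<kappa>) \<eta>2)"
proof (induction arbitrary: \<eta> \<eta>1 \<eta>2 a rule: has_type.induct)
  case (WeakTU \<Sigma> \<Delta> \<phi> T U T' U')
  have "affine_rel a (RProp T U) (sem M \<phi> Prop \<eta>) (sem M \<phi> Prop \<eta>1) (sem M \<phi> Prop \<eta>2)"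
    using WeakTU.IH[OF WeakTU.prems] by simp
  then show ?case
    by (elim affine_rel_RPropE) (use WeakTU.hyps prop_set_mono in \<open>force simp: affine_rel_RProp\<close>)
next
  case (Weak \<Sigma> \<Delta> \<phi> \<kappa> X T U)
  \<comment> \<open>X is mixed in the larger context but must be constant in the smaller one;
    resetting it repairs this without changing the meaning of \<phi>.\<close>
  let ?\<eta>1 = "\<eta>1(X := \<eta> X)" and ?\<eta>2 = "\<eta>2(X := \<eta> X)"
  have X: "X \<notin> dom (ctx_ty \<Sigma> \<Delta>)"
    using Weak.hyps by (auto simp: ctx_ty_def tr_env_def dom_def)
  have "env_rel a \<Delta> \<eta> ?\<eta>1 ?\<eta>2"
  proof (rule env_relI)
    fix Y T' U' assume Y: "(Y, T', U') \<in> set \<Delta>"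
    then have "Y \<noteq> X" using Weak.hyps(3) by force
    then show "affine_rel a (RProp T' U') (\<eta> Y) (?\<eta>1 Y) (?\<eta>2 Y)"
      using env_rel_bound[OF Weak.prems(5), of Y T' U'] Y by (simp del: affine_rel.simps)
  qed (use env_rel_unbound[OF Weak.prems(5)] in auto)
  then have "affine_rel a \<kappa> (sem M \<phi> (tr \<kappa>) \<eta>) (sem M \<phi> (tr \<kappa>) ?\<eta>1) (sem M \<phi> (tr \<kappa>) ?\<eta>2)"
    using Weak.IH Weak.prems by blast
  moreover have "sem M \<phi> (tr \<kappa>) (\<eta>'(X := d)) = sem M \<phi> (tr \<kappa>) \<eta>'" for \<eta>' d
    using X by (intro sem_cong[OF has_type_simply_typed[OF Weak.hyps(1)]]) auto
  ultimately show ?case by simp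
next
  case (Ex \<Sigma> \<Delta>1 b1 b2 \<Delta>2 \<phi> \<kappa>)
  have "env_rel a (\<Delta>1 @ b1 # b2 # \<Delta>2) \<eta> \<eta>1 \<eta>2"
    using env_rel_unbound[OF Ex.prems(5)] env_rel_bound[OF Ex.prems(5)] by (intro env_relI) auto
  then show ?case using Ex.IH Ex.prems by blast
next
  case (AP \<Sigma> p)
  then show ?case by (auto simp: env_rel_Nil affine_rel_RProp prop_set_def unit_val_def)
next
  case (FVar \<Sigma> X \<kappa>)
  then show ?case by (auto simp: env_rel_Nil dom_env_def dom_rty_iff)
next
  case (Var \<Sigma> X T U)
  show ?case using env_rel_bound[OF Var.prems(5), of X T U] by simp
next
  case (Mu \<Sigma> X \<kappa> \<phi>)
  \<comment> \<open>The induction hypothesis at every weight, with one environment taken three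
    times, says that the body maps \<open>dom_rty \<kappa>\<close> into itself.\<close>
  have "sem M \<phi> (tr \<kappa>) (\<eta>(X := d)) \<in> dom_rty \<kappa>" if "d \<in> dom_rty \<kappa>" for d
  proof -
    note \<eta> = dom_env_upd[OF Mu.prems(2) that]
    have "env_rel a [] (\<eta>(X := d)) (\<eta>(X := d)) (\<eta>(X := d))" for a
      unfolding env_rel_Nil by blast
    moreover have "phfl_formula \<phi>" using Mu.prems(1) by simp
    ultimately show ?thesis
      unfolding dom_rty_iff by (intro conjI allI impI sem_in_dom_ty[OF M Mu.hyps(1) \<eta>] Mu.IH \<eta>)
  qed
  from sem_fix_in_dom_rty(1)[OF M Mu.hyps(1) Mu.prems(2) this Mu.hyps(3)]
  show ?case using Mu.prems(3-5) by (simp add: dom_rty_iff env_rel_Nil)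
next
  case (Nu \<Sigma> X \<kappa> \<phi>)
  have "sem M \<phi> (tr \<kappa>) (\<eta>(X := d)) \<in> dom_rty \<kappa>" if "d \<in> dom_rty \<kappa>" for d
  proof -
    note \<eta> = dom_env_upd[OF Nu.prems(2) that]
    have "env_rel a [] (\<eta>(X := d)) (\<eta>(X := d)) (\<eta>(X := d))" for a
      unfolding env_rel_Nil by blast
    moreover have "phfl_formula \<phi>" using Nu.prems(1) by simp
    ultimately show ?thesis
      unfolding dom_rty_iff by (intro conjI allI impI sem_in_dom_ty[OF M Nu.hyps(1) \<eta>] Nu.IH \<eta>)
  qed
  from sem_fix_in_dom_rty(2)[OF M Nu.hyps(1) Nu.prems(2) this Nu.hyps(3)]
  show ?case using Nu.prems(3-5) by (simp add: dom_rty_iff env_rel_Nil)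
next
  case (Abs \<Sigma> \<Delta> X T U \<phi> \<kappa>)
  have X: "X \<notin> dom \<Sigma>" "X \<notin> fst ` set \<Delta>"
    using has_type_distinct[OF Abs.hyps(1)] by auto
  show ?case unfolding affine_rel.simps
  proof (intro ballI)
    fix u v assume uv: "u \<in> prop_set (T, U)" "v \<in> prop_set (T, U)"
    let ?w = "mix a u v"
    let ?\<eta> = "\<eta>(X := VProp ?w)" and ?\<eta>1 = "\<eta>1(X := VProp u)" and ?\<eta>2 = "\<eta>2(X := VProp v)"
    note un = prop_set_unit_val[OF uv(1)] prop_set_unit_val[OF uv(2)]
      prop_set_unit_val[OF mix_in_prop_set[OF Abs.prems(3,4) uv]]
    have "?\<eta> \<in> dom_env \<Sigma>"
      \<comment> \<open>The bound variable is not in \<Sigma>, so assigning it leaves the values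
        required by \<Sigma> untouched.\<close>
      using X(1) by (intro dom_env_cong[OF Abs.prems(2)]) auto
    moreover have "env_rel a (\<Delta> @ [(X, T, U)]) ?\<eta> ?\<eta>1 ?\<eta>2"
    proof (rule env_relI)
      fix Y T' U' assume Y: "(Y, T', U') \<in> set (\<Delta> @ [(X, T, U)])"
      show "affine_rel a (RProp T' U') (?\<eta> Y) (?\<eta>1 Y) (?\<eta>2 Y)"
      proof (cases "Y = X")
        case True
        then have "T' = T" "U' = U" using Y X(2) by force+
        then show ?thesis using True uv by simp
      next
        case False
        then show ?thesis
          using env_rel_bound[OF Abs.prems(5), of Y T' U'] Y by (simp del: affine_rel.simps)
      qed
    qed (use env_rel_unbound[OF Abs.prems(5)] in auto)
    ultimately have "affine_rel a \<kappa> (sem M \<phi> (tr \<kappa>) ?\<eta>) (sem M \<phi> (tr \<kappa>) ?\<eta>1) (sem M \<phi> (tr \<kappa>) ?\<eta>2)"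
      using Abs.IH Abs.prems(1,3,4) by simp
    then show "affine_rel a \<kappa> (the_fun (sem M (Lam X \<phi>) (tr (RFun T U \<kappa>)) \<eta>) ?w)
        (the_fun (sem M (Lam X \<phi>) (tr (RFun T U \<kappa>)) \<eta>1) u)
        (the_fun (sem M (Lam X \<phi>) (tr (RFun T U \<kappa>)) \<eta>2) v)"
      using un by simp
  qed
next
  case (App \<Sigma> \<Delta> \<phi> T U \<kappa> \<psi>)
  have \<psi>: "affine_rel a (RProp T U) (sem M \<psi> Prop \<eta>) (sem M \<psi> Prop \<eta>1) (sem M \<psi> Prop \<eta>2)"
    using App.IH(2) App.prems by simp
  have \<phi>: "affine_rel a (RFun T U \<kappa>) (sem M \<phi> (PropTo (tr \<kappa>)) \<eta>)
      (sem M \<phi> (PropTo (tr \<kappa>)) \<eta>1) (sem M \<phi> (PropTo (tr \<kappa>)) \<eta>2)"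
    using App.IH(1) App.prems by simp
  from \<psi> show ?case by (rule affine_rel_RPropE) (use \<phi> in simp)
next
  case (Conj \<Sigma> \<Delta> \<phi> T1 U1 \<psi> T2 U2)
  have \<phi>: "affine_rel a (RProp T1 U1) (sem M \<phi> Prop \<eta>) (sem M \<phi> Prop \<eta>1) (sem M \<phi> Prop \<eta>2)"
    using Conj.IH(1) Conj.prems by simp
  have \<psi>: "affine_rel a (RProp T2 U2) (sem M \<psi> Prop \<eta>) (sem M \<psi> Prop \<eta>1) (sem M \<psi> Prop \<eta>2)"
    using Conj.IH(2) Conj.prems by simp
  from \<phi> obtain u u' where u: "sem M \<phi> Prop \<eta> = VProp (mix a u u')" "sem M \<phi> Prop \<eta>1 = VProp u"
    "sem M \<phi> Prop \<eta>2 = VProp u'" "u \<in> prop_set (T1, U1)" "u' \<in> prop_set (T1, U1)"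
    by (rule affine_rel_RPropE)
  from \<psi> obtain v v' where v: "sem M \<psi> Prop \<eta> = VProp (mix a v v')" "sem M \<psi> Prop \<eta>1 = VProp v"
    "sem M \<psi> Prop \<eta>2 = VProp v'" "v \<in> prop_set (T2, U2)" "v' \<in> prop_set (T2, U2)"
    by (rule affine_rel_RPropE)
  \<comment> \<open>For empty \<Delta> both mixtures are trivial; otherwise the side condition of
    the rule applies.\<close>
  have "(\<lambda>s. min (mix a u u' s) (mix a v v' s)) = mix a (\<lambda>s. min (u s) (v s)) (\<lambda>s. min (u' s) (v' s))"
  proof (cases "\<Delta> = []")
    case True
    then have "u' = u" "v' = v" using Conj.prems(5) u(2,3) v(2,3) by (simp_all add: env_rel_Nil)
    then show ?thesis by simp
  next
    case False
    then show ?thesis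
      using min_max_mix(1)[OF Conj.hyps(3) Conj.prems(3,4) u(4,5) v(4,5)] by simp
  qed
  then show ?case
    using min_max_prop_set(1)[OF u(4) v(4)] min_max_prop_set(1)[OF u(5) v(5)]
    by (simp only: sem.simps tr.simps u(1-3) v(1-3) val.sel affine_rel_RProp)
next
  case (Disj \<Sigma> \<Delta> \<phi> T1 U1 \<psi> T2 U2)
  have \<phi>: "affine_rel a (RProp T1 U1) (sem M \<phi> Prop \<eta>) (sem M \<phi> Prop \<eta>1) (sem M \<phi> Prop \<eta>2)"
    using Disj.IH(1) Disj.prems by simp
  have \<psi>: "affine_rel a (RProp T2 U2) (sem M \<psi> Prop \<eta>) (sem M \<psi> Prop \<eta>1) (sem M \<psi> Prop \<eta>2)"
    using Disj.IH(2) Disj.prems by simp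
  from \<phi> obtain u u' where u: "sem M \<phi> Prop \<eta> = VProp (mix a u u')" "sem M \<phi> Prop \<eta>1 = VProp u"
    "sem M \<phi> Prop \<eta>2 = VProp u'" "u \<in> prop_set (T1, U1)" "u' \<in> prop_set (T1, U1)"
    by (rule affine_rel_RPropE)
  from \<psi> obtain v v' where v: "sem M \<psi> Prop \<eta> = VProp (mix a v v')" "sem M \<psi> Prop \<eta>1 = VProp v"
    "sem M \<psi> Prop \<eta>2 = VProp v'" "v \<in> prop_set (T2, U2)" "v' \<in> prop_set (T2, U2)"
    by (rule affine_rel_RPropE)
  have "(\<lambda>s. max (mix a u u' s) (mix a v v' s)) = mix a (\<lambda>s. max (u s) (v s)) (\<lambda>s. max (u' s) (v' s))"
  proof (cases "\<Delta> = []")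
    case True
    then have "u' = u" "v' = v" using Disj.prems(5) u(2,3) v(2,3) by (simp_all add: env_rel_Nil)
    then show ?thesis by simp
  next
    case False
    then show ?thesis
      using min_max_mix(2)[OF Disj.hyps(3) Disj.prems(3,4) u(4,5) v(4,5)] by simp
  qed
  then show ?case
    using min_max_prop_set(2)[OF u(4) v(4)] min_max_prop_set(2)[OF u(5) v(5)]
    by (simp only: sem.simps tr.simps u(1-3) v(1-3) val.sel affine_rel_RProp)
next
  case (J \<Sigma> \<phi> T U J)
  have \<phi>: "affine_rel a (RProp T U) (sem M \<phi> Prop \<eta>) (sem M \<phi> Prop \<eta>1) (sem M \<phi> Prop \<eta>2)"
    using J.IH J.prems by simp
  have eq: "\<eta>1 = \<eta>" "\<eta>2 = \<eta>" using J.prems(5) by (simp_all add: env_rel_Nil)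
  from \<phi> obtain v where v: "sem M \<phi> Prop \<eta> = VProp v" "v \<in> prop_set (T, U)"
    unfolding eq by (elim affine_rel_RPropE) blast
  show ?case
    using threshold_prop_set[OF _ v(2)] J.prems(1)
    by (simp add: eq v affine_rel_RProp del: affine_rel.simps)
next
  case (Min \<Sigma> \<phi> T U)
  have \<phi>: "affine_rel a (RProp T U) (sem M \<phi> Prop \<eta>) (sem M \<phi> Prop \<eta>1) (sem M \<phi> Prop \<eta>2)"
    using Min.IH Min.prems by simp
  have eq: "\<eta>1 = \<eta>" "\<eta>2 = \<eta>" using Min.prems(5) by (simp_all add: env_rel_Nil)
  from \<phi> obtain v where v: "sem M \<phi> Prop \<eta> = VProp v" "v \<in> prop_set (T, U)"
    unfolding eq by (elim affine_rel_RPropE) blast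
  show ?case
    using Min_succs_prop_set[OF M v(2)]
    by (simp add: eq v affine_rel_RProp del: affine_rel.simps)
next
  case (Max \<Sigma> \<phi> T U)
  have \<phi>: "affine_rel a (RProp T U) (sem M \<phi> Prop \<eta>) (sem M \<phi> Prop \<eta>1) (sem M \<phi> Prop \<eta>2)"
    using Max.IH Max.prems by simp
  have eq: "\<eta>1 = \<eta>" "\<eta>2 = \<eta>" using Max.prems(5) by (simp_all add: env_rel_Nil)
  from \<phi> obtain v where v: "sem M \<phi> Prop \<eta> = VProp v" "v \<in> prop_set (T, U)"
    unfolding eq by (elim affine_rel_RPropE) blast
  show ?case
    using Max_succs_prop_set[OF M v(2)]
    by (simp add: eq v affine_rel_RProp del: affine_rel.simps)
next
  case (Avg \<Sigma> \<Delta> \<phi> T U)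
  have \<phi>: "affine_rel a (RProp T U) (sem M \<phi> Prop \<eta>) (sem M \<phi> Prop \<eta>1) (sem M \<phi> Prop \<eta>2)"
    using Avg.IH Avg.prems by simp
  then obtain u v where uv: "sem M \<phi> Prop \<eta> = VProp (mix a u v)" "sem M \<phi> Prop \<eta>1 = VProp u"
    "sem M \<phi> Prop \<eta>2 = VProp v" "u \<in> prop_set (T, U)" "v \<in> prop_set (T, U)"
    by (rule affine_rel_RPropE)
  \<comment> \<open>Expectation is linear, so no condition on T and U is required for
    mixing.\<close>
  have "(\<lambda>s. \<Sum>t\<in>UNIV. trans M s t * mix a u v t) =
      mix a (\<lambda>s. \<Sum>t\<in>UNIV. trans M s t * u t) (\<lambda>s. \<Sum>t\<in>UNIV. trans M s t * v t)"
    by (simp add: mix_def fun_eq_iff sum_distrib_left algebra_simps flip: sum.distrib)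
  then show ?case
    using expectation_prop_set[OF M uv(4)] expectation_prop_set[OF M uv(5)]
    by (simp only: sem.simps tr.simps uv(1-3) val.sel affine_rel_RProp)
qed

text \<open>Repeated abstraction, from the last binding inwards, moves the whole of \<Delta> into
  the formula and its type.\<close>

lemma has_type_lam_seq:
  "has_type M \<Sigma> \<Delta> \<phi> \<kappa> \<Longrightarrow> has_type M \<Sigma> [] (lam_seq \<Delta> \<phi>) (fun_seq \<Delta> \<kappa>)"
proof (induction \<Delta> arbitrary: \<phi> \<kappa> rule: rev_induct)
  case Nil
  then show ?case by (simp add: lam_seq_def fun_seq_def)
next
  case (snoc b \<Delta>)
  obtain X T U where b: "b = (X, T, U)" by (cases b)
  have "has_type M \<Sigma> \<Delta> (Lam X \<phi>) (RFun T U \<kappa>)" using snoc.prems b by (auto intro: has_type.Abs)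
  from snoc.IH[OF this] show ?case by (simp add: b lam_seq_def fun_seq_def)
qed

lemma phfl_formula_lam_seq: "phfl_formula \<phi> \<Longrightarrow> phfl_formula (lam_seq \<Delta> \<phi>)"
  by (induction \<Delta>) (auto simp: lam_seq_def)

theorem theorem5p8:
  fixes M :: "('s::finite, 'p) chain"
    and \<Sigma> :: "'x \<rightharpoonup> 's rty"
    and \<Delta> :: "('x, 's) binding list"
    and \<phi> :: "('p, 'x) form"
    and \<kappa> :: "'s rty"
  assumes "markov_chain M"
    and "phfl_formula \<phi>"
    and "has_type M \<Sigma> \<Delta> \<phi> \<kappa>"
  shows "\<forall>\<eta>\<in>dom_env \<Sigma>.
    denotation M (tr_env \<Sigma>) (lam_seq \<Delta> \<phi>) (tr (fun_seq \<Delta> \<kappa>)) \<eta> \<in> dom_rty (fun_seq \<Delta> \<kappa>)"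
proof
  fix \<eta> assume \<eta>: "\<eta> \<in> dom_env \<Sigma>"
  let ?\<phi> = "lam_seq \<Delta> \<phi>" and ?\<kappa> = "fun_seq \<Delta> \<kappa>"
  have ty: "has_type M \<Sigma> [] ?\<phi> ?\<kappa>" by (rule has_type_lam_seq[OF assms(3)])
  \<comment> \<open>With the context emptied, the same \<eta> fills all three places; affinity in
    the variables of \<Delta> is now contained in the relation at the function type.\<close>
  have "affine_rel a ?\<kappa> (sem M ?\<phi> (tr ?\<kappa>) \<eta>) (sem M ?\<phi> (tr ?\<kappa>) \<eta>) (sem M ?\<phi> (tr ?\<kappa>) \<eta>)"
    if "0 \<le> a" "a \<le> 1" for a
    by (rule has_type_sound[OF assms(1) ty phfl_formula_lam_seq[OF assms(2)] \<eta> that])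
      (simp add: env_rel_Nil)
  then have "sem M ?\<phi> (tr ?\<kappa>) \<eta> \<in> dom_rty ?\<kappa>"
    using sem_in_dom_ty[OF assms(1) ty \<eta>] by (simp add: dom_rty_iff)
  then show "denotation M (tr_env \<Sigma>) ?\<phi> (tr ?\<kappa>) \<eta> \<in> dom_rty ?\<kappa>"
    using has_type_simply_typed[OF ty] by (simp add: denotation_def)
qed

end
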